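(* Let $G$ be a critical graph. For every edge $e$ of $G$ there is a $\{K_{1,1}, K_{1,2}, C_m : m\ge 3\}$-factor $F$ of $G$ with $e\in E(F)$.
   Context: All graphs are finite and simple. $\Delta(G)$ is the maximum degree. The edge-chromatic number $\chi'(G)$ is the minimum number of matchings needed to cover $E(G)$. For an integer $k\ge 2$, a graph $G$ is $k$-critical if $\Delta(G)=k$, $\chi'(G)=k+1$ and $\chi'(H)\le k$ for each proper subgraph $H$ of $G$; $G$ is critical if it is $k$-critical for some $k\ge 2$. $K_{1,i}$ is the star with $i$ edges and $C_m$ is the circuit (connected 2-regular graph) on $m$ vertices. A $\{K_{1,1}, K_{1,2}, C_m : m\ge 3\}$-factor of $G$ is a spanning subgraph each of whose components is isomorphic to $K_{1,1}$, $K_{1,2}$, or $C_m$ for some $m\ge 3$. *)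

theory Defs
  imports Main
begin

record 'a ugraph =
  verts :: "'a set"
  edges :: "'a set set"

definition simple_graph :: "'a ugraph \<Rightarrow> bool" where
  "simple_graph G \<longleftrightarrow> finite (verts G) \<and> (\<forall>e\<in>edges G. e \<subseteq> verts G \<and> card e = 2)"

definition vdegree :: "'a ugraph \<Rightarrow> 'a \<Rightarrow> nat" where
  "vdegree G v = card {e \<in> edges G. v \<in> e}"

text \<open>The inserted 0 only matters for the graph without vertices, whose maximum degree is thus 0.\<close>

definition max_degree :: "'a ugraph \<Rightarrow> nat" where
  "max_degree G = Max (insert 0 (vdegree G ` verts G))"

definition subgraph :: "'a ugraph \<Rightarrow> 'a ugraph \<Rightarrow> bool" where
  "subgraph H G \<longleftrightarrow> simple_graph H \<and> simple_graph G \<and> verts H \<subseteq> verts G \<and> edges H \<subseteq> edges G"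

definition spanning_subgraph :: "'a ugraph \<Rightarrow> 'a ugraph \<Rightarrow> bool" where
  "spanning_subgraph H G \<longleftrightarrow> subgraph H G \<and> verts H = verts G"

definition graph_matching :: "'a ugraph \<Rightarrow> 'a set set \<Rightarrow> bool" where
  "graph_matching G M \<longleftrightarrow> M \<subseteq> edges G \<and> pairwise disjnt M"

definition edge_chromatic_number :: "'a ugraph \<Rightarrow> nat" where
  "edge_chromatic_number G =
     (LEAST n. \<exists>\<M>. finite \<M> \<and> card \<M> = n \<and> (\<forall>M\<in>\<M>. graph_matching G M) \<and> edges G \<subseteq> \<Union>\<M>)"

definition k_critical :: "nat \<Rightarrow> 'a ugraph \<Rightarrow> bool" where
  "k_critical k G \<longleftrightarrow>
     simple_graph G \<and> max_degree G = k \<and> edge_chromatic_number G = k + 1 \<and>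
     (\<forall>H. subgraph H G \<and> H \<noteq> G \<longrightarrow> edge_chromatic_number H \<le> k)"

definition critical :: "'a ugraph \<Rightarrow> bool" where
  "critical G \<longleftrightarrow> (\<exists>k\<ge>2. k_critical k G)"

definition connected_graph :: "'a ugraph \<Rightarrow> bool" where
  "connected_graph G \<longleftrightarrow> verts G \<noteq> {} \<and>
     (\<forall>u\<in>verts G. \<forall>v\<in>verts G. (u, v) \<in> {(x, y). {x, y} \<in> edges G}\<^sup>*)"

text \<open>Components are the maximal connected subgraphs.\<close>

definition graph_component :: "'a ugraph \<Rightarrow> 'a ugraph \<Rightarrow> bool" where
  "graph_component C G \<longleftrightarrow> subgraph C G \<and> connected_graph C \<and>
     (\<forall>H. subgraph H G \<and> connected_graph H \<and> subgraph C H \<longrightarrow> H = C)"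

definition graph_iso :: "'a ugraph \<Rightarrow> 'b ugraph \<Rightarrow> bool" where
  "graph_iso G H \<longleftrightarrow>
     (\<exists>f. bij_betw f (verts G) (verts H) \<and> edges H = (\<lambda>e. f ` e) ` edges G)"

text \<open>The star \<open>K\<^bsub>1,i\<^esub>\<close> with centre 0 and leaves \<open>1, \<dots>, i\<close>.\<close>

definition star_graph :: "nat \<Rightarrow> nat ugraph" where
  "star_graph i = \<lparr>verts = {0..i}, edges = {{0, j} |j. j \<in> {1..i}}\<rparr>"

text \<open>The property of being a \<open>C\<^sub>m\<close>; it is invariant under isomorphism.\<close>

definition circuit :: "nat \<Rightarrow> 'a ugraph \<Rightarrow> bool" where
  "circuit m C \<longleftrightarrow> simple_graph C \<and> connected_graph C \<and>
     (\<forall>v\<in>verts C. vdegree C v = 2) \<and> card (verts C) = m"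

definition star_circuit_factor :: "'a ugraph \<Rightarrow> 'a ugraph \<Rightarrow> bool" where
  "star_circuit_factor G F \<longleftrightarrow> spanning_subgraph F G \<and>
     (\<forall>C. graph_component C F \<longrightarrow>
        graph_iso C (star_graph 1) \<or> graph_iso C (star_graph 2) \<or> (\<exists>m\<ge>3. circuit m C))"

end

(*
By Hall's theorem there is a map phi on the vertices with phi(v) adjacent to v, all fibres of size at
most 2, phi(x) = y and no preimage of x, where e = xy. Hall's condition follows from Vizing's adjacency
lemma by discharging: a nonempty set J of vertices satisfies |J| <= 2|N(J)| - 2, and even
|J| <= 2|N(J)| - 3 if some vertex of N(J) has a neighbour outside J. The functional graph of phi is cut
into stars K_{1,1}, K_{1,2} and circuits by letting a vertex be a leaf iff none of its preimages is a
leaf; the vertices that this recursion leaves undecided form cycles of phi. A vertex without preimages,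
such as x, is a leaf, so the edge xy survives.
*)
theory Submission
  imports Defs Complex_Main
begin

text \<open>Cutting phi drops the edge {v, phi v} of every star centre v, so phi x = y alone would
  not save e. A vertex without preimages is never a centre, hence x gets capacity 0. Measured
  against capacity 2 everywhere, this loses 2 at x, and 1 more at y for the slot kept for x: these
  losses are the origin of the constants 2 and 3. The loss at y counts only if y lies in N(J), and
  then x is a neighbour of y outside J, so the sharper bound is available. Hall's condition rests on
  the fact that a vertex with a neighbour of degree d has at most d - 1 neighbours of degree below
  k. So few vertices of small degree, whose charges are large, send to the same neighbour, and each
  vertex of N(J) receives at most 2 - 2/D, where D is the largest degree in J. Since |N(J)| is at
  least D, the total loss is at least 2.\<close>

section \<open>Fans and Kempe chains\<close>

definition nbrs :: "'a set set \<Rightarrow> 'a \<Rightarrow> 'a set" where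
  "nbrs E v = {u. {u, v} \<in> E}"

definition proper_colouring :: "'a set set \<Rightarrow> nat \<Rightarrow> ('a set \<Rightarrow> nat) \<Rightarrow> bool" where
  "proper_colouring E k c \<longleftrightarrow>
     (\<forall>e\<in>E. c e < k) \<and> (\<forall>e\<in>E. \<forall>f\<in>E. e \<noteq> f \<longrightarrow> e \<inter> f \<noteq> {} \<longrightarrow> c e \<noteq> c f)"

definition missing :: "'a set set \<Rightarrow> nat \<Rightarrow> ('a set \<Rightarrow> nat) \<Rightarrow> 'a \<Rightarrow> nat set" where
  "missing E k c v = {\<alpha>. \<alpha> < k \<and> (\<forall>e\<in>E. v \<in> e \<longrightarrow> c e \<noteq> \<alpha>)}"

text \<open>The vertices reachable from \<open>y\<close> along \<open>fan_step\<close> are those of the maximal multi-fan at \<open>x\<close> that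
  starts with the uncoloured edge \<open>{x, y}\<close>.\<close>

definition fan_step :: "'a set set \<Rightarrow> nat \<Rightarrow> ('a set \<Rightarrow> nat) \<Rightarrow> 'a \<Rightarrow> ('a \<times> 'a) set" where
  "fan_step E k c x = {(u, z). {x, z} \<in> E \<and> c {x, z} \<in> missing E k c u}"

lemma nbrs_sym: "u \<in> nbrs E v \<longleftrightarrow> v \<in> nbrs E u"
  by (simp add: nbrs_def insert_commute)

lemma finite_nbrs:
  assumes "finite E" "\<And>e. e \<in> E \<Longrightarrow> card e = 2"
  shows "finite (nbrs E v)"
proof (rule finite_subset)
  show "nbrs E v \<subseteq> \<Union>E" by (auto simp: nbrs_def)
  show "finite (\<Union>E)" using assms by (metis card.infinite finite_Union zero_neq_numeral)
qed

lemma card_incident: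
  assumes "\<And>e. e \<in> E \<Longrightarrow> card e = 2"
  shows "card {e \<in> E. v \<in> e} = card (nbrs E v)"
proof -
  have "bij_betw (\<lambda>u. {u, v}) (nbrs E v) {e \<in> E. v \<in> e}"
    unfolding bij_betw_def
  proof
    show "inj_on (\<lambda>u. {u, v}) (nbrs E v)"
      by (auto simp: inj_on_def doubleton_eq_iff)
    show "(\<lambda>u. {u, v}) ` nbrs E v = {e \<in> E. v \<in> e}"
    proof (intro equalityI subsetI)
      fix e assume e: "e \<in> {e \<in> E. v \<in> e}"
      then obtain u where "e = {u, v}"
        using assms[of e] by (auto simp: card_2_iff)
      then show "e \<in> (\<lambda>u. {u, v}) ` nbrs E v"
        using e by (auto simp: nbrs_def)
    qed (auto simp: nbrs_def)
  qed
  then show ?thesis by (simp add: bij_betw_same_card)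
qed

lemma proper_colouringD:
  assumes "proper_colouring E k c" "e \<in> E" "f \<in> E" "e \<noteq> f" "v \<in> e" "v \<in> f"
  shows "c e \<noteq> c f"
  using assms unfolding proper_colouring_def by (metis disjoint_iff)

lemma proper_colouringI:
  assumes "\<And>e. e \<in> E \<Longrightarrow> c e < k"
    and "\<And>e f v. e \<in> E \<Longrightarrow> f \<in> E \<Longrightarrow> e \<noteq> f \<Longrightarrow> v \<in> e \<Longrightarrow> v \<in> f \<Longrightarrow> c e \<noteq> c f"
  shows "proper_colouring E k c"
  using assms unfolding proper_colouring_def by (metis disjoint_iff)

lemma proper_colouring_cong_nbr:
  assumes "proper_colouring E k c" "{u, v} \<in> E" "{u, w} \<in> E" "c {u, v} = c {u, w}"
  shows "v = w"
proof -
  have "{u, v} = {u, w}"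
    using proper_colouringD[OF assms(1-3), of u] assms(4) by blast
  then show ?thesis by (auto simp: doubleton_eq_iff)
qed

lemma card_missing:
  assumes "finite E" "\<And>e. e \<in> E \<Longrightarrow> card e = 2" "proper_colouring E k c"
  shows "card (missing E k c v) = k - card (nbrs E v)"
proof -
  let ?I = "{e \<in> E. v \<in> e}"
  have "inj_on c ?I"
    using proper_colouringD[OF assms(3)] by (auto simp: inj_on_def)
  then have "card (c ` ?I) = card (nbrs E v)"
    using card_incident[OF assms(2)] card_image by metis
  moreover have "c ` ?I \<subseteq> {..<k}"
    using assms(3) unfolding proper_colouring_def by auto
  moreover have "missing E k c v = {..<k} - c ` ?I"
    unfolding missing_def by auto
  ultimately show ?thesis
    using assms(1) by (simp add: card_Diff_subset)
qed

text \<open>At \<open>y\<close> the new colour is free by the fan step. At \<open>x\<close> its only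
  other bearer is \<open>{x, z}\<close>, which becomes the uncoloured edge.\<close>

lemma fan_shift:
  assumes c: "proper_colouring (E - {{x, y}}) k c" and xy: "{x, y} \<in> E"
    and st: "(y, z) \<in> fan_step (E - {{x, y}}) k c x"
  shows "proper_colouring (E - {{x, z}}) k (c({x, y} := c {x, z}))"
proof -
  have xz: "{x, z} \<in> E" "{x, z} \<noteq> {x, y}"
    and free: "\<And>e. e \<in> E - {{x, y}} \<Longrightarrow> y \<in> e \<Longrightarrow> c e \<noteq> c {x, z}"
    and lt: "c {x, z} < k"
    using st unfolding fan_step_def missing_def by auto
  have new: "c f \<noteq> c {x, z}"
    if f: "f \<in> E - {{x, z}}" "f \<noteq> {x, y}" "v \<in> f" "v \<in> {x, y}" for f v
  proof (cases "v = y")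
    case True
    then show ?thesis using free[of f] f by blast
  next
    case False
    then have "x \<in> f" using f by blast
    then show ?thesis using proper_colouringD[OF c, of f "{x, z}" x] f xz by blast
  qed
  show ?thesis
  proof (rule proper_colouringI)
    fix e assume "e \<in> E - {{x, z}}"
    then show "(c({x, y} := c {x, z})) e < k"
      using lt c unfolding proper_colouring_def by auto
  next
    fix e f v assume ef: "e \<in> E - {{x, z}}" "f \<in> E - {{x, z}}" "e \<noteq> f" "v \<in> e" "v \<in> f"
    show "(c({x, y} := c {x, z})) e \<noteq> (c({x, y} := c {x, z})) f"
    proof (cases "e = {x, y} \<or> f = {x, y}")
      case True
      then show ?thesis using new[of e v] new[of f v] ef by (metis fun_upd_apply)
    next
      case False
      then show ?thesis using proper_colouringD[OF c, of e f v] ef by auto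
    qed
  qed
qed

text \<open>A shortest chain violating the claim is shortened further: colouring \<open>{x, y}\<close> like the first edge
  \<open>{x, z}\<close> of the chain leaves \<open>{x, z}\<close> uncoloured and keeps the rest of the chain, unless it returns to \<open>z\<close>.\<close>

lemma fan_chain_missing_disjoint:
  assumes unc: "\<nexists>c. proper_colouring E k c" and two: "\<And>e. e \<in> E \<Longrightarrow> card e = 2"
  shows "proper_colouring (E - {{x, y}}) k c \<Longrightarrow> {x, y} \<in> E \<Longrightarrow> f 0 = y \<Longrightarrow>
    (\<And>i. i < n \<Longrightarrow> (f i, f (Suc i)) \<in> fan_step (E - {{x, y}}) k c x) \<Longrightarrow>
    missing (E - {{x, y}}) k c x \<inter> missing (E - {{x, y}}) k c (f n) = {}"
proof (induction n arbitrary: y c f rule: less_induct)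
  case (less n)
  note c = less.prems(1) and xy = less.prems(2) and f0 = less.prems(3) and ch = less.prems(4)
  let ?E = "E - {{x, y}}"
  have neq: "u \<noteq> v" if "{u, v} \<in> E" for u v using two[OF that] by auto
  show ?case
  proof (rule ccontr)
    assume "\<not> ?thesis"
    then obtain \<alpha> where a: "\<alpha> \<in> missing ?E k c x" "\<alpha> \<in> missing ?E k c (f n)" by blast
    show False
    proof (cases n)
      case 0
      have "proper_colouring E k (c({x, y} := \<alpha>))"
        using c a f0 0 unfolding proper_colouring_def missing_def by auto
      then show False using unc by blast
    next
      case (Suc m)
      define z where "z = f 1"
      have st: "(y, z) \<in> fan_step ?E k c x"
        using ch[of 0] f0 Suc by (simp add: z_def)
      have xz: "{x, z} \<in> E" "{x, z} \<noteq> {x, y}" using st unfolding fan_step_def by auto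
      have fE: "{x, f (Suc i)} \<in> ?E" if "i < n" for i
        using ch[OF that] unfolding fan_step_def by auto
      show False
      proof (cases "\<exists>j. 2 \<le> j \<and> j \<le> n \<and> f j = z")
        case True
        then obtain j where j: "2 \<le> j" "j \<le> n" "f j = z" by blast
        \<comment> \<open>The part of the chain between two visits to \<open>z\<close> is cut out;
          \<open>2 \<le> j\<close> makes the remainder shorter than \<open>n\<close>.\<close>
        define g where "g i = (if i = 0 then y else f (i + j - 1))" for i
        have "missing ?E k c x \<inter> missing ?E k c (g (n - j + 1)) = {}"
        proof (rule less.IH[OF _ c xy])
          show "n - j + 1 < n" using j by simp
          show "g 0 = y" by (simp add: g_def)
          fix i assume i: "i < n - j + 1"
          show "(g i, g (Suc i)) \<in> fan_step ?E k c x"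
          proof (cases i)
            case 0
            then show ?thesis using st j by (simp add: g_def)
          next
            case (Suc l)
            have "l + j < n" using i Suc by simp
            then show ?thesis using ch[of "l + j"] Suc by (simp add: g_def)
          qed
        qed
        moreover have "g (n - j + 1) = f n" using j by (simp add: g_def)
        ultimately show False using a by auto
      next
        case False
        \<comment> \<open>The shift keeps the set of colours at \<open>x\<close> and can only free
          colours at the vertices \<open>f (Suc i)\<close>, none of which is \<open>y\<close>. So
          the tail of the chain remains a chain for the shifted colouring.\<close>
        let ?c = "c({x, y} := c {x, z})" and ?E' = "E - {{x, z}}"
        have c': "proper_colouring ?E' k ?c" by (rule fan_shift[OF c xy st])
        have fneq: "f (Suc i) \<noteq> x \<and> f (Suc i) \<noteq> y" if "i < n" for i
          using fE[OF that] neq by blast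
        have miss: "missing ?E k c (f (Suc i)) \<subseteq> missing ?E' k ?c (f (Suc i))" if "i < n" for i
          using fneq[OF that] unfolding missing_def by auto
        have missx: "missing ?E k c x \<subseteq> missing ?E' k ?c x"
          using xz unfolding missing_def by auto
        have "missing ?E' k ?c x \<inter> missing ?E' k ?c (f (Suc m)) = {}"
        proof (rule less.IH[OF _ c' xz(1), of m "\<lambda>i. f (Suc i)"])
          show "m < n" using Suc by simp
          show "f (Suc 0) = z" by (simp add: z_def)
          fix i assume i: "i < m"
          have i': "Suc i < n" using i Suc by simp
          have "f (Suc (Suc i)) \<noteq> z" using False i' by auto
          then have "{x, f (Suc (Suc i))} \<in> ?E'" "{x, f (Suc (Suc i))} \<noteq> {x, y}"
            using fE[OF i'] by (auto simp: doubleton_eq_iff)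
          moreover have "c {x, f (Suc (Suc i))} \<in> missing ?E k c (f (Suc i))"
            using ch[OF i'] unfolding fan_step_def by auto
          ultimately show "(f (Suc i), f (Suc (Suc i))) \<in> fan_step ?E' k ?c x"
            using miss[of i] i' unfolding fan_step_def by auto
        qed
        then show False using a miss[of m] missx Suc by auto
      qed
    qed
  qed
qed

lemma fan_missing_disjoint_centre:
  assumes "\<nexists>c. proper_colouring E k c" "\<And>e. e \<in> E \<Longrightarrow> card e = 2"
    and "proper_colouring (E - {{x, y}}) k c" "{x, y} \<in> E"
    and "(y, z) \<in> (fan_step (E - {{x, y}}) k c x)\<^sup>*"
  shows "missing (E - {{x, y}}) k c x \<inter> missing (E - {{x, y}}) k c z = {}"
proof -
  obtain n where "(y, z) \<in> (fan_step (E - {{x, y}}) k c x) ^^ n"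
    using assms(5) rtrancl_imp_relpow by blast
  then obtain f where "f 0 = y" "f n = z"
    "\<And>i. i < n \<Longrightarrow> (f i, f (Suc i)) \<in> fan_step (E - {{x, y}}) k c x"
    unfolding relpow_fun_conv by blast
  then show ?thesis
    using fan_chain_missing_disjoint[OF assms(1,2,3,4), of f n] by blast
qed

text \<open>A component of maximum degree 2 has at most two vertices of degree at most 1: a shortest
  walk between two of them exhausts the component, and each inner vertex has two distinct neighbours
  on the walk.\<close>

lemma path_end_unique:
  assumes sym: "sym R"
    and two: "\<And>v a b d. (v, a) \<in> R \<Longrightarrow> (v, b) \<in> R \<Longrightarrow> (v, d) \<in> R \<Longrightarrow> a \<noteq> b \<Longrightarrow> d = a \<or> d = b"
    and p: "\<And>a b. (p, a) \<in> R \<Longrightarrow> (p, b) \<in> R \<Longrightarrow> a = b"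
    and q: "\<And>a b. (q, a) \<in> R \<Longrightarrow> (q, b) \<in> R \<Longrightarrow> a = b"
    and x: "\<And>a b. (x, a) \<in> R \<Longrightarrow> (x, b) \<in> R \<Longrightarrow> a = b"
    and pq: "(p, q) \<in> R\<^sup>*" and px: "(p, x) \<in> R\<^sup>*" and neq: "p \<noteq> q" "x \<noteq> p"
  shows "x = q"
proof (rule ccontr)
  assume xq: "x \<noteq> q"
  define n where "n = (LEAST n. (p, q) \<in> R ^^ n)"
  have "\<exists>n. (p, q) \<in> R ^^ n" using pq rtrancl_imp_relpow by blast
  then have n: "(p, q) \<in> R ^^ n" and least: "\<And>m. (p, q) \<in> R ^^ m \<Longrightarrow> n \<le> m"
    unfolding n_def by (auto intro: LeastI_ex Least_le)
  obtain f where f: "f 0 = p" "f n = q" "\<And>i. i < n \<Longrightarrow> (f i, f (Suc i)) \<in> R"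
    using n unfolding relpow_fun_conv by blast
  have bwd: "(f (Suc i), f i) \<in> R" if "i < n" for i
    using f(3)[OF that] sym by (auto dest: symD)
  \<comment> \<open>A walk that turns back can be shortened by two steps.\<close>
  have turn: "f i \<noteq> f (Suc (Suc i))" if i: "Suc (Suc i) \<le> n" for i
  proof
    assume eq: "f i = f (Suc (Suc i))"
    have "(p, f i) \<in> R ^^ i"
      unfolding relpow_fun_conv using f i by (intro exI[of _ f]) auto
    moreover have "(f (Suc (Suc i)), q) \<in> R ^^ (n - Suc (Suc i))"
      unfolding relpow_fun_conv
    proof (intro exI[of _ "\<lambda>j. f (Suc (Suc i) + j)"] conjI allI impI)
      show "f (Suc (Suc i) + (n - Suc (Suc i))) = q"
        using f(2) i by (simp only: le_add_diff_inverse)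
    qed (use f(3) in auto)
    ultimately have "(p, q) \<in> R ^^ (i + (n - Suc (Suc i)))"
      unfolding relpow_add eq by blast
    then show False using least i by fastforce
  qed
  have n0: "0 < n" using f neq by (cases n) auto
  \<comment> \<open>No edge leaves the walk: an inner vertex already has both its neighbours on it,
    an end its only one.\<close>
  have closed: "b \<in> f ` {..n}" if ab: "a \<in> f ` {..n}" "(a, b) \<in> R" for a b
  proof -
    obtain i where i: "i \<le> n" "a = f i" using ab by auto
    consider "i = 0" | "i = n" | j where "i = Suc j" "i < n" using i(1) by (cases i) fastforce+
    then show ?thesis
    proof cases
      case 1
      then have "b = f 1" using p f(1) f(3)[of 0] n0 ab i by simp
      then show ?thesis using n0 by auto
    next
      case 2
      then have "b = f (n - 1)" using q f(2) bwd[of "n - 1"] n0 ab i by simp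
      then show ?thesis by auto
    next
      case 3
      have "b = f j \<or> b = f (Suc (Suc j))"
        using two[OF bwd[of j] f(3)[of "Suc j"]] turn[of j] ab i 3 by auto
      then show ?thesis using 3 by auto
    qed
  qed
  have "x \<in> f ` {..n}"
    using px
  proof (induction rule: rtrancl_induct)
    case base
    then show ?case using f(1) by (metis atMost_iff image_eqI le0)
  qed (rule closed)
  then obtain i where i: "i \<le> n" "x = f i" by auto
  then have "i \<noteq> 0" "i \<noteq> n" using f neq xq by metis+
  then obtain j where j: "i = Suc j" "Suc (Suc j) \<le> n" using i by (cases i) auto
  have "f j = f (Suc (Suc j))"
    using x[of "f j" "f (Suc (Suc j))"] bwd[of j] f(3)[of "Suc j"] i j by simp
  then show False using turn j by blast
qed

section \<open>Kempe chains and the exchange of two colours\<close>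

definition kempe :: "'a set set \<Rightarrow> ('a set \<Rightarrow> nat) \<Rightarrow> nat \<Rightarrow> nat \<Rightarrow> ('a \<times> 'a) set" where
  "kempe E c \<alpha> \<beta> = {(u, v). {u, v} \<in> E \<and> c {u, v} \<in> {\<alpha>, \<beta>}}"

text \<open>Edges are selected by meeting \<open>K\<close>. When \<open>K\<close> is closed under
  \<open>kempe\<close>, the edges of colour \<alpha> or \<beta> that meet \<open>K\<close> lie
  inside it, so this is the usual exchange on a union of Kempe components.\<close>

definition kempe_swap :: "('a set \<Rightarrow> nat) \<Rightarrow> nat \<Rightarrow> nat \<Rightarrow> 'a set \<Rightarrow> 'a set \<Rightarrow> nat" where
  "kempe_swap c \<alpha> \<beta> K e =
     (if e \<inter> K = {} then c e else if c e = \<alpha> then \<beta> else if c e = \<beta> then \<alpha> else c e)"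

lemma sym_kempe: "sym (kempe E c \<alpha> \<beta>)"
  by (auto simp: kempe_def sym_def insert_commute)

lemma kempe_two:
  assumes "proper_colouring E k c" "(v, a) \<in> kempe E c \<alpha> \<beta>" "(v, b) \<in> kempe E c \<alpha> \<beta>"
    "(v, d) \<in> kempe E c \<alpha> \<beta>" "a \<noteq> b"
  shows "d = a \<or> d = b"
proof -
  have "{v, a} \<in> E" "{v, b} \<in> E" "{v, d} \<in> E"
    and "c {v, a} = c {v, b} \<or> c {v, d} = c {v, a} \<or> c {v, d} = c {v, b}"
    using assms(2-4) unfolding kempe_def by auto
  then show ?thesis
    using proper_colouring_cong_nbr[OF assms(1)] assms(5) by metis
qed

lemma kempe_end:
  assumes c: "proper_colouring E k c" and m: "\<alpha> \<in> missing E k c v \<or> \<beta> \<in> missing E k c v"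
    and ab: "(v, a) \<in> kempe E c \<alpha> \<beta>" "(v, b) \<in> kempe E c \<alpha> \<beta>"
  shows "a = b"
proof (rule proper_colouring_cong_nbr[OF c])
  show "{v, a} \<in> E" "{v, b} \<in> E" using ab unfolding kempe_def by auto
  have "c {v, a} \<noteq> \<gamma> \<and> c {v, b} \<noteq> \<gamma>" if "\<gamma> \<in> missing E k c v" for \<gamma>
    using that ab unfolding kempe_def missing_def by auto
  then show "c {v, a} = c {v, b}"
    using m ab unfolding kempe_def by auto
qed

locale kempe_component =
  fixes E :: "'a set set" and k c \<alpha> \<beta> and K :: "'a set"
  assumes pairs: "\<And>e. e \<in> E \<Longrightarrow> card e = 2"
    and col: "proper_colouring E k c" and lt: "\<alpha> < k" "\<beta> < k"
    and closed: "\<And>u v. (u, v) \<in> kempe E c \<alpha> \<beta> \<Longrightarrow> u \<in> K \<Longrightarrow> v \<in> K"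
begin

abbreviation "c' \<equiv> kempe_swap c \<alpha> \<beta> K"

lemma meets_iff:
  assumes "e \<in> E" "c e \<in> {\<alpha>, \<beta>}" "v \<in> e"
  shows "e \<inter> K = {} \<longleftrightarrow> v \<notin> K"
proof -
  obtain a b where e: "e = {a, b}" using pairs[OF assms(1)] by (auto simp: card_2_iff)
  have "(a, b) \<in> kempe E c \<alpha> \<beta>" using e assms by (simp add: kempe_def)
  then have "a \<in> K \<longleftrightarrow> b \<in> K"
    using closed sym_kempe by (metis symD)
  then show ?thesis using assms(3) e by auto
qed

text \<open>Around a single vertex the exchange is either the identity or the transposition of
  \<alpha> and \<beta>. Properness and missing colours can therefore be checked vertex by
  vertex.\<close>

lemma swap_at:
  assumes "e \<in> E" "v \<in> e"
  shows "c' e = (if v \<notin> K then c e else if c e = \<alpha> then \<beta> else if c e = \<beta> then \<alpha> else c e)"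
  using meets_iff[OF assms(1) _ assms(2)] assms(2) unfolding kempe_swap_def
  by (cases "c e \<in> {\<alpha>, \<beta>}") auto

lemma proper_swap: "proper_colouring E k c'"
proof (rule proper_colouringI)
  fix e assume "e \<in> E"
  then show "c' e < k" using col lt unfolding kempe_swap_def proper_colouring_def by auto
next
  fix e f v assume "e \<in> E" "f \<in> E" "e \<noteq> f" "v \<in> e" "v \<in> f"
  then show "c' e \<noteq> c' f"
    using proper_colouringD[OF col, of e f v] by (simp add: swap_at[of _ v] split: if_splits)
qed

lemma missing_swap_outside: "v \<notin> K \<Longrightarrow> missing E k c' v = missing E k c v"
  unfolding missing_def by (auto simp: swap_at[of _ v])

lemma missing_swap_other:
  "\<gamma> \<noteq> \<alpha> \<Longrightarrow> \<gamma> \<noteq> \<beta> \<Longrightarrow> \<gamma> \<in> missing E k c' v \<longleftrightarrow> \<gamma> \<in> missing E k c v"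
  unfolding missing_def by (auto simp: swap_at[of _ v] split: if_splits)

lemma missing_swap_inside:
  "v \<in> K \<Longrightarrow> \<alpha> \<in> missing E k c v \<Longrightarrow> \<beta> \<in> missing E k c' v"
  unfolding missing_def using lt by (auto simp: swap_at[of _ v] split: if_splits)

end

section \<open>Multi-fans and Vizing's adjacency lemma\<close>

locale uncolourable_edge =
  fixes E :: "'a set set" and k c x y
  assumes unc: "\<nexists>c. proper_colouring E k c" and two: "\<And>e. e \<in> E \<Longrightarrow> card e = 2"
    and c: "proper_colouring (E - {{x, y}}) k c" and xy: "{x, y} \<in> E"
begin

abbreviation "D \<equiv> E - {{x, y}}"

lemma twoD: "e \<in> D \<Longrightarrow> card e = 2"
  using two by blast

lemma edge_neq: "{u, v} \<in> E \<Longrightarrow> u \<noteq> v"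
  using two[of "{u, v}"] by auto

lemma centre_disjoint:
  "(y, z) \<in> (fan_step D k c x)\<^sup>* \<Longrightarrow> missing D k c x \<inter> missing D k c z = {}"
  using fan_missing_disjoint_centre[OF unc two c xy] .

text \<open>If the Kempe chain of \<open>u\<close> avoided \<open>x\<close>, exchanging its colours
  would make \<beta> missing at \<open>u\<close> while it stays missing at \<open>x\<close>. The fan
  still reaches \<open>u\<close> after the exchange, which contradicts
  \<open>centre_disjoint\<close> for the new colouring.\<close>

lemma fan_kempe:
  assumes u: "(y, u) \<in> (fan_step D k c x)\<^sup>*"
    and \<alpha>: "\<alpha> \<in> missing D k c u" and \<beta>: "\<beta> \<in> missing D k c x"
  shows "(u, x) \<in> (kempe D c \<alpha> \<beta>)\<^sup>*"
proof (rule ccontr)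
  assume nx: "(u, x) \<notin> (kempe D c \<alpha> \<beta>)\<^sup>*"
  define K where "K = (kempe D c \<alpha> \<beta>)\<^sup>* `` {u}"
  interpret kempe_component D k c \<alpha> \<beta> K
  proof
    show "\<alpha> < k" "\<beta> < k" using \<alpha> \<beta> unfolding missing_def by auto
  qed (use twoD c in \<open>auto simp: K_def\<close>)
  have xK: "x \<notin> K" and uK: "u \<in> K" using nx unfolding K_def by auto
  interpret s: uncolourable_edge E k c' x y
    using unc two proper_swap xy by (rule uncolourable_edge.intro)
  have \<beta>': "\<beta> \<in> missing D k c' x" using missing_swap_outside[OF xK] \<beta> by simp
  \<comment> \<open>Swapping colours on \<open>K\<close> can only break the chain at a vertex of \<open>K\<close> that missed \<open>\<alpha>\<close>; this vertex then misses \<open>\<beta>\<close>, as \<open>x\<close> does.\<close>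
  have reach: "(y, w) \<in> (fan_step D k c' x)\<^sup>*" if "(y, w) \<in> (fan_step D k c x)\<^sup>*" for w
    using that
  proof (induction rule: rtrancl_induct)
    case (step v w)
    let ?\<gamma> = "c {x, w}"
    have w: "{x, w} \<in> D" and \<gamma>: "?\<gamma> \<in> missing D k c v"
      using step(2) unfolding fan_step_def by auto
    have same: "c' {x, w} = ?\<gamma>" using swap_at[OF w, of x] xK by simp
    have "?\<gamma> \<noteq> \<beta>" using \<beta> w unfolding missing_def by auto
    moreover have "\<beta> \<notin> missing D k c' v" using s.centre_disjoint[OF step.IH] \<beta>' by blast
    ultimately have "?\<gamma> \<in> missing D k c' v"
      using missing_swap_outside[of v] missing_swap_inside[of v] missing_swap_other[of ?\<gamma> v] \<gamma>
      by metis
    then have "(v, w) \<in> fan_step D k c' x" using w same unfolding fan_step_def by simp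
    then show ?case using step.IH by simp
  qed simp
  show False
    using s.centre_disjoint[OF reach[OF u]] \<beta>' missing_swap_inside[OF uK \<alpha>] by blast
qed

lemma fan_neq_centre:
  assumes "(y, u) \<in> (fan_step D k c x)\<^sup>*"
  shows "{x, u} \<in> E" "u \<noteq> x"
proof -
  show "{x, u} \<in> E"
    using assms xy by (induction rule: rtrancl_induct) (auto simp: fan_step_def)
  then show "u \<noteq> x" using edge_neq by blast
qed

lemma fan_disjoint:
  assumes u: "(y, u) \<in> (fan_step D k c x)\<^sup>*" and v: "(y, v) \<in> (fan_step D k c x)\<^sup>*"
    and neq: "u \<noteq> v" and free: "missing D k c x \<noteq> {}"
  shows "missing D k c u \<inter> missing D k c v = {}"
proof (rule ccontr)
  assume "\<not> ?thesis"
  then obtain \<alpha> where \<alpha>: "\<alpha> \<in> missing D k c u" "\<alpha> \<in> missing D k c v" by blast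
  obtain \<beta> where \<beta>: "\<beta> \<in> missing D k c x" using free by blast
  let ?R = "kempe D c \<alpha> \<beta>"
  have ux: "(u, x) \<in> ?R\<^sup>*" and vx: "(v, x) \<in> ?R\<^sup>*"
    using fan_kempe u v \<alpha> \<beta> by auto
  have "(x, v) \<in> ?R\<^sup>*"
    using vx sym_rtrancl[OF sym_kempe] by (metis symD)
  with ux have uv: "(u, v) \<in> ?R\<^sup>*" by simp
  \<comment> \<open>The three vertices \<open>u\<close>, \<open>v\<close>, \<open>x\<close> would all be ends of the same Kempe path.\<close>
  have "x = v"
    by (rule path_end_unique[OF sym_kempe kempe_two[OF c] kempe_end[OF c] kempe_end[OF c]
          kempe_end[OF c] uv ux neq]) (use \<alpha> \<beta> fan_neq_centre[OF u] in auto)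
  then show False using fan_neq_centre[OF v] by blast
qed

text \<open>The proof counts colours on the maximal fan \<open>R\<close>. Each \<open>v\<close> in
  \<open>R - {y}\<close> misses \<open>k - d(v)\<close> colours, where d is the degree in
  \<open>E\<close>, and \<open>y\<close> misses one more than \<open>k - d(y)\<close> because
  \<open>{x, y}\<close> is uncoloured. These sets are disjoint, and together they have at most
  \<open>card (R - {y})\<close> colours; so enough vertices of \<open>R - {y}\<close> must
  contribute nothing, that is, have degree \<open>k\<close>.\<close>

lemma adjacency:
  assumes fin: "finite E" and deg: "\<And>v. card (nbrs E v) \<le> k"
  shows "k + 1 \<le> card (nbrs E y) + card {z \<in> nbrs E x. z \<noteq> y \<and> card (nbrs E z) = k}"
proof -
  define R where "R = {z. (y, z) \<in> (fan_step D k c x)\<^sup>*}"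
  let ?M = "missing D k c"
  have yR: "y \<in> R" by (simp add: R_def)
  have RN: "R \<subseteq> nbrs E x"
    using fan_neq_centre unfolding R_def nbrs_def by (auto simp: insert_commute)
  have finN: "finite (nbrs E v)" for v by (rule finite_nbrs[OF fin two])
  have finR: "finite R" using RN finN finite_subset by blast
  have nD: "nbrs D v = nbrs E v" if "v \<noteq> x" "v \<noteq> y" for v
    using that by (auto simp: nbrs_def doubleton_eq_iff)
  have nDx: "nbrs D x = nbrs E x - {y}" and nDy: "nbrs D y = nbrs E y - {x}"
    using edge_neq[OF xy] by (auto simp: nbrs_def doubleton_eq_iff)
  have inx: "y \<in> nbrs E x" and iny: "x \<in> nbrs E y"
    using xy by (auto simp: nbrs_def insert_commute)
  have pos: "card (nbrs E x) > 0" "card (nbrs E y) > 0"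
    using inx iny finN by (auto simp: card_gt_0_iff)
  have finD: "finite D" using fin by simp
  have cM: "card (?M v) = k - card (nbrs D v)" for v
    using card_missing[OF finD twoD c] .
  have finM: "finite (?M v)" for v unfolding missing_def by simp
  have "card (nbrs D x) < k" using deg[of x] pos inx by (simp add: nDx)
  then have "card (?M x) > 0" using cM by simp
  then have free: "?M x \<noteq> {}" by auto
  \<comment> \<open>Here the maximality of the fan enters: a colour missing at a fan vertex is
    present at \<open>x\<close>, and the edge that bears it leads to another fan vertex.\<close>
  have "(\<Union>v\<in>R. ?M v) \<subseteq> (\<lambda>z. c {x, z}) ` (R - {y})"
  proof
    fix \<alpha> assume "\<alpha> \<in> (\<Union>v\<in>R. ?M v)"
    then obtain v where v: "v \<in> R" "\<alpha> \<in> ?M v" by blast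
    then have "\<alpha> \<notin> ?M x" using centre_disjoint unfolding R_def by blast
    then obtain e where e: "e \<in> D" "x \<in> e" "c e = \<alpha>"
      using v(2) unfolding missing_def by auto
    then obtain z where z: "e = {x, z}"
      using twoD[OF e(1)] by (auto simp: card_2_iff insert_commute)
    have "(v, z) \<in> fan_step D k c x" using e v z unfolding fan_step_def by auto
    then have "z \<in> R" using v(1) unfolding R_def by auto
    then show "\<alpha> \<in> (\<lambda>z. c {x, z}) ` (R - {y})" using e z by auto
  qed
  then have "card (\<Union>v\<in>R. ?M v) \<le> card (R - {y})"
    using finR by (meson card_image_le card_mono finite_Diff finite_imageI le_trans)
  moreover have "card (\<Union>v\<in>R. ?M v) = (\<Sum>v\<in>R. card (?M v))"
    using fan_disjoint free finR finM unfolding R_def by (intro card_UN_disjoint) auto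
  moreover have "(\<Sum>v\<in>R. card (?M v)) = card (?M y) + (\<Sum>v\<in>R - {y}. card (?M v))"
    using finR yR by (simp add: sum.remove)
  moreover have "card (?M y) = k - (card (nbrs E y) - 1)"
    using cM iny finN by (simp add: nDy)
  moreover have "(\<Sum>v\<in>R - {y}. card (?M v)) = (\<Sum>v\<in>R - {y}. k - card (nbrs E v))"
    using cM nD fan_neq_centre unfolding R_def by (intro sum.cong) auto
  moreover have "(\<Sum>v\<in>R - {y}. if card (nbrs E v) = k then 0 else 1) \<le> (\<Sum>v\<in>R - {y}. k - card (nbrs E v))"
  proof (rule sum_mono)
    show "(if card (nbrs E v) = k then 0 else 1) \<le> k - card (nbrs E v)" for v
      using deg[of v] by (cases "card (nbrs E v) = k") simp_all
  qed
  moreover have "(\<Sum>v\<in>R - {y}. if card (nbrs E v) = k then 0 else 1) =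
      card (R - {y}) - card {v \<in> R - {y}. card (nbrs E v) = k}"
  proof -
    have "(\<Sum>v\<in>R - {y}. if card (nbrs E v) = k then 0 else 1) = card (R - {y} - {v \<in> R - {y}. card (nbrs E v) = k})"
      using finR by (subst card_eq_sum, intro sum.mono_neutral_cong_right) auto
    also have "\<dots> = card (R - {y}) - card {v \<in> R - {y}. card (nbrs E v) = k}"
      using finR by (intro card_Diff_subset) auto
    finally show ?thesis .
  qed
  moreover have "card {v \<in> R - {y}. card (nbrs E v) = k} \<le> card {z \<in> nbrs E x. z \<noteq> y \<and> card (nbrs E z) = k}"
    using RN finN by (intro card_mono) auto
  moreover have "card {v \<in> R - {y}. card (nbrs E v) = k} \<le> card (R - {y})"
    using finR by (intro card_mono) auto
  ultimately show ?thesis using deg[of y] pos(2) by linarith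
qed

end

section \<open>Hall's theorem and functional graphs\<close>

text \<open>Induction after Halmos and Vaughan. A tight nonempty proper subset \<open>J\<close> is
  matched first, and its tightness passes Hall's condition to the rest with the neighbours of
  \<open>J\<close> removed. Without such a subset every nonempty proper subset has a surplus, which
  pays for fixing one arbitrary pair.\<close>

lemma hall:
  fixes N :: "'a \<Rightarrow> 'b set"
  assumes "finite A" "\<And>v. v \<in> A \<Longrightarrow> finite (N v)"
    and "\<And>J. J \<subseteq> A \<Longrightarrow> card J \<le> card (\<Union>v\<in>J. N v)"
  shows "\<exists>f. inj_on f A \<and> (\<forall>v\<in>A. f v \<in> N v)"
  using assms
proof (induction A arbitrary: N rule: finite_psubset_induct)
  case (psubset A)
  note fin = psubset.prems(1) and hall = psubset.prems(2)
  have finU: "finite (\<Union>v\<in>J. N v)" if "J \<subseteq> A" for J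
    using that fin finite_subset[OF _ psubset.hyps] by (intro finite_UN_I) auto
  show ?case
  proof (cases "\<exists>J. J \<noteq> {} \<and> J \<subset> A \<and> card (\<Union>v\<in>J. N v) \<le> card J")
    case True
    then obtain J where J: "J \<noteq> {}" "J \<subset> A" "card (\<Union>v\<in>J. N v) \<le> card J" by blast
    define U where "U = (\<Union>v\<in>J. N v)"
    have "\<exists>f. inj_on f J \<and> (\<forall>v\<in>J. f v \<in> N v)"
      using J(2) fin hall by (intro psubset.IH) auto
    then obtain f where f: "inj_on f J" "\<forall>v\<in>J. f v \<in> N v" by blast
    have "\<exists>g. inj_on g (A - J) \<and> (\<forall>v\<in>A - J. g v \<in> N v - U)"
    proof (intro psubset.IH)
      show "A - J \<subset> A" using J by blast
      show "finite (N v - U)" if "v \<in> A - J" for v using that fin by simp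
      fix J' assume J': "J' \<subseteq> A - J"
      have finJ: "finite J" "finite J'"
        using J' J(2) psubset.hyps by (auto intro: finite_subset)
      have "card J' + card J = card (J' \<union> J)"
        using J' finJ by (subst card_Un_disjoint) auto
      also have "\<dots> \<le> card (\<Union>v\<in>J' \<union> J. N v)" using J J' by (intro hall) auto
      also have "(\<Union>v\<in>J' \<union> J. N v) = (\<Union>v\<in>J'. N v - U) \<union> U" unfolding U_def by auto
      also have "card \<dots> \<le> card (\<Union>v\<in>J'. N v - U) + card U" by (rule card_Un_le)
      finally show "card J' \<le> card (\<Union>v\<in>J'. N v - U)" using J(3) by (simp add: U_def)
    qed
    then obtain g where g: "inj_on g (A - J)" "\<forall>v\<in>A - J. g v \<in> N v - U" by blast
    have fU: "f v \<in> U" if "v \<in> J" for v using f that unfolding U_def by auto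
    show ?thesis
    proof (intro exI conjI ballI)
      show "inj_on (\<lambda>v. if v \<in> J then f v else g v) A"
        using f(1) g fU unfolding inj_on_def by (metis DiffI Diff_iff)
      show "(if v \<in> J then f v else g v) \<in> N v" if "v \<in> A" for v
        using that f(2) g(2) by auto
    qed
  next
    case False
    show ?thesis
    proof (cases "A = {}")
      case ne: False
      then obtain a where a: "a \<in> A" by blast
      have "card {a} \<le> card (\<Union>v\<in>{a}. N v)" using a by (intro hall) auto
      then have "N a \<noteq> {}" by auto
      then obtain b where b: "b \<in> N a" by blast
      have "\<exists>g. inj_on g (A - {a}) \<and> (\<forall>v\<in>A - {a}. g v \<in> N v - {b})"
      proof (intro psubset.IH)
        show "A - {a} \<subset> A" using a by blast
        show "finite (N v - {b})" if "v \<in> A - {a}" for v using that fin by simp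
        fix J assume J: "J \<subseteq> A - {a}"
        show "card J \<le> card (\<Union>v\<in>J. N v - {b})"
        proof (cases "J = {}")
          case False
          then have "card J < card (\<Union>v\<in>J. N v)"
            using J a \<open>\<not> (\<exists>J. J \<noteq> {} \<and> J \<subset> A \<and> card (\<Union>v\<in>J. N v) \<le> card J)\<close>
            by (metis DiffD2 Diff_subset in_mono insertI1 linorder_not_less psubsetI subset_trans)
          moreover have "(\<Union>v\<in>J. N v - {b}) = (\<Union>v\<in>J. N v) - {b}" by blast
          ultimately show ?thesis by (simp only: card_Diff_singleton_if split: if_split) linarith
        qed simp
      qed
      then obtain g where g: "inj_on g (A - {a})" "\<forall>v\<in>A - {a}. g v \<in> N v - {b}" by blast
      show ?thesis
      proof (intro exI conjI ballI)
        show "inj_on (g(a := b)) A"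
          using g a unfolding inj_on_def by (metis DiffE DiffI fun_upd_apply singletonD singletonI)
        show "(g(a := b)) v \<in> N v" if "v \<in> A" for v using that g(2) b by auto
      qed
    qed simp
  qed
qed

text \<open>Hall's theorem is applied after replacing each \<open>u\<close> by \<open>c u\<close>
  copies.\<close>

lemma hall_capacities:
  fixes N :: "'a \<Rightarrow> 'b set" and c :: "'b \<Rightarrow> nat"
  assumes fin: "finite A" "\<And>v. v \<in> A \<Longrightarrow> finite (N v)"
    and cond: "\<And>J. J \<subseteq> A \<Longrightarrow> card J \<le> (\<Sum>u\<in>(\<Union>v\<in>J. N v). c u)"
  shows "\<exists>f. (\<forall>v\<in>A. f v \<in> N v) \<and> (\<forall>u. card {v \<in> A. f v = u} \<le> c u)"
proof -
  have "\<exists>g. inj_on g A \<and> (\<forall>v\<in>A. g v \<in> Sigma (N v) (\<lambda>u. {..<c u}))"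
  proof (rule hall)
    fix J assume J: "J \<subseteq> A"
    have "(\<Union>v\<in>J. Sigma (N v) (\<lambda>u. {..<c u})) = Sigma (\<Union>v\<in>J. N v) (\<lambda>u. {..<c u})" by blast
    moreover have "finite (\<Union>v\<in>J. N v)"
      using J fin by (meson finite_UN_I finite_subset subsetD)
    ultimately show "card J \<le> card (\<Union>v\<in>J. Sigma (N v) (\<lambda>u. {..<c u}))"
      using cond[OF J] by simp
  qed (use fin in auto)
  then obtain g where g: "inj_on g A" "\<And>v. v \<in> A \<Longrightarrow> g v \<in> Sigma (N v) (\<lambda>u. {..<c u})" by blast
  have "card {v \<in> A. fst (g v) = u} \<le> c u" for u
  proof -
    have "inj_on (snd \<circ> g) {v \<in> A. fst (g v) = u}"
      using g(1) unfolding inj_on_def by (auto simp: prod_eq_iff)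
    moreover have "(snd \<circ> g) ` {v \<in> A. fst (g v) = u} \<subseteq> {..<c u}"
      using g(2) by fastforce
    ultimately show ?thesis using card_inj_on_le[of _ _ "{..<c u}"] by fastforce
  qed
  moreover have "fst (g v) \<in> N v" if "v \<in> A" for v using g(2)[OF that] by auto
  ultimately show ?thesis by (intro exI[of _ "\<lambda>v. fst (g v)"]) blast
qed

text \<open>Vertices of \<open>L\<close> will be leaves of stars and those of \<open>C\<close> centres, each \<open>v \<in> L\<close> being joined to \<open>\<phi> v\<close>.
  In a maximal such labelling every unlabelled vertex has an unlabelled preimage, so \<open>\<phi>\<close> permutes
  the unlabelled vertices.\<close>

lemma functional_graph_kernel:
  assumes fin: "finite V"
  obtains L C Z where "V = L \<union> C \<union> Z" "L \<inter> C = {}" "L \<inter> Z = {}" "C \<inter> Z = {}"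
    "\<And>v w. v \<in> L \<Longrightarrow> w \<in> V \<Longrightarrow> \<phi> w = v \<Longrightarrow> w \<in> C"
    "\<And>v. v \<in> C \<Longrightarrow> \<exists>w\<in>L. \<phi> w = v"
    "\<And>v. v \<in> L \<Longrightarrow> \<phi> v \<notin> Z"
    "bij_betw \<phi> Z Z"
proof -
  define P where "P = (\<lambda>(L, C). L \<union> C \<subseteq> V \<and> L \<inter> C = {} \<and>
    (\<forall>v\<in>L. \<forall>w\<in>V. \<phi> w = v \<longrightarrow> w \<in> C) \<and> (\<forall>v\<in>C. \<exists>w\<in>L. \<phi> w = v))"
  have "P ({}, {})" unfolding P_def by simp
  moreover have "\<forall>y. P y \<longrightarrow> card (fst y \<union> snd y) < Suc (card V)"
    unfolding P_def using fin by (auto simp: less_Suc_eq_le intro: card_mono)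
  ultimately obtain x where x: "P x" "\<And>y. P y \<Longrightarrow> card (fst y \<union> snd y) \<le> card (fst x \<union> snd x)"
    using ex_has_greatest_nat[of P _ "\<lambda>y. card (fst y \<union> snd y)"] by blast
  obtain L C where LC: "x = (L, C)" by (cases x)
  have sub: "L \<union> C \<subseteq> V" and dis: "L \<inter> C = {}"
    and L: "\<And>v w. v \<in> L \<Longrightarrow> w \<in> V \<Longrightarrow> \<phi> w = v \<Longrightarrow> w \<in> C"
    and C: "\<And>v. v \<in> C \<Longrightarrow> \<exists>w\<in>L. \<phi> w = v"
    using x(1) unfolding P_def LC by auto
  define Z where "Z = V - (L \<union> C)"
  have finLC: "finite (L \<union> C)" using sub fin finite_subset by blast
  have maximal: False if "P (L', C')" "L' \<union> C' = insert v (L \<union> C)" "v \<in> Z" for L' C' v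
    using x(2)[OF that(1)] that(2,3) finLC by (simp add: LC Z_def)
  have LZ: "\<phi> w \<notin> Z" if w: "w \<in> L" for w
  proof
    assume v: "\<phi> w \<in> Z"
    have "P (L, insert (\<phi> w) C)"
      using w v sub dis L C unfolding P_def Z_def by auto
    then show False by (rule maximal[OF _ _ v]) simp
  qed
  \<comment> \<open>If all preimages of \<open>v\<close> were labelled, they would be centres, since
    \<open>LZ\<close> forbids a leaf to map to \<open>v\<close>; then \<open>v\<close> could be made
    a leaf.\<close>
  have child: "\<exists>w\<in>Z. \<phi> w = v" if v: "v \<in> Z" for v
  proof (rule ccontr)
    assume "\<not> ?thesis"
    then have "w \<in> C" if "w \<in> V" "\<phi> w = v" for w
      using that v LZ unfolding Z_def by blast
    then have "P (insert v L, C)"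
      using v sub dis L C unfolding P_def Z_def by auto
    then show False by (rule maximal[OF _ _ v]) simp
  qed
  \<comment> \<open>A priori \<phi> may lead from \<open>Z\<close> into \<open>C\<close>. Counting
    excludes this: the members of \<open>Z\<close> that stay in \<open>Z\<close> already cover
    \<open>Z\<close>, so they are all of it.\<close>
  define Z' where "Z' = {z \<in> Z. \<phi> z \<in> Z}"
  have img: "\<phi> ` Z' = Z" using child unfolding Z'_def by force
  have finZ: "finite Z" "finite Z'" using fin unfolding Z'_def Z_def by auto
  have "card Z \<le> card Z'" using img card_image_le finZ by metis
  then have "Z' = Z" using finZ by (intro card_seteq) (auto simp: Z'_def)
  then have "bij_betw \<phi> Z Z"
    using img finZ eq_card_imp_inj_on unfolding bij_betw_def by metis
  then show thesis
    using that[of L C Z] sub dis L C LZ unfolding Z_def by blast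
qed

text \<open>A centre drops its edge to its image, while leaves and vertices of \<open>Z\<close> keep
  theirs. The components are then stars with one or two leaves and the cycles of \<phi> on
  \<open>Z\<close>, a cycle of length 2 collapsing to a single edge. The last two properties
  describe such a graph locally; equal degrees on both sides of a degree-2 vertex exclude paths with
  three or more edges.\<close>

lemma star_circuit_edges:
  assumes fin: "finite V" and maps: "\<And>v. v \<in> V \<Longrightarrow> \<phi> v \<in> V \<and> \<phi> v \<noteq> v"
    and fibre: "\<And>u. card {v \<in> V. \<phi> v = u} \<le> 2"
  obtains F where "F \<subseteq> (\<lambda>v. {v, \<phi> v}) ` V"
    "\<And>v. v \<in> V \<Longrightarrow> \<forall>u\<in>V. \<phi> u \<noteq> v \<Longrightarrow> {v, \<phi> v} \<in> F"
    "\<And>v. v \<in> V \<Longrightarrow> card (nbrs F v) \<in> {1, 2}"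
    "\<And>v u w. card (nbrs F v) = 2 \<Longrightarrow> u \<in> nbrs F v \<Longrightarrow> w \<in> nbrs F v \<Longrightarrow>
       card (nbrs F u) = card (nbrs F w)"
proof -
  obtain L C Z where V: "V = L \<union> C \<union> Z" and dis: "L \<inter> C = {}" "L \<inter> Z = {}" "C \<inter> Z = {}"
    and L: "\<And>v w. v \<in> L \<Longrightarrow> w \<in> V \<Longrightarrow> \<phi> w = v \<Longrightarrow> w \<in> C"
    and C: "\<And>v. v \<in> C \<Longrightarrow> \<exists>w\<in>L. \<phi> w = v"
    and LZ: "\<And>v. v \<in> L \<Longrightarrow> \<phi> v \<notin> Z"
    and Z: "bij_betw \<phi> Z Z"
    using functional_graph_kernel[OF fin, of \<phi> thesis] by metis
  define F where "F = (\<lambda>v. {v, \<phi> v}) ` (L \<union> Z)"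
  have nF: "nbrs F v = {w. w = \<phi> v \<and> v \<in> L \<union> Z \<or> w \<in> L \<union> Z \<and> \<phi> w = v}" for v
    unfolding nbrs_def F_def image_iff by (auto simp: doubleton_eq_iff)
  have ZZ: "\<phi> v \<in> Z" if "v \<in> Z" for v using Z that by (auto simp: bij_betw_def)
  have Zinj: "v = w" if "v \<in> Z" "w \<in> Z" "\<phi> v = \<phi> w" for v w
    using Z that by (auto simp: bij_betw_def inj_on_def)
  have LC: "\<phi> v \<in> C" if "v \<in> L" for v
    using maps[of v] L[of "\<phi> v" v] LZ[of v] that V dis by blast
  have nL: "nbrs F v = {\<phi> v}" if "v \<in> L" for v
    using that L[of v] ZZ dis V unfolding nF by blast
  have nC: "nbrs F v = {w \<in> L. \<phi> w = v}" if "v \<in> C" for v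
    using that ZZ dis V unfolding nF by blast
  have pred: "\<exists>u\<in>Z. \<phi> u = v \<and> nbrs F v = {\<phi> v, u}" if v: "v \<in> Z" for v
  proof -
    obtain u where u: "u \<in> Z" "\<phi> u = v" using bij_betw_imp_surj_on[OF Z] v by (metis imageE)
    have uniq: "w = u" if "w \<in> L \<union> Z" "\<phi> w = v" for w
      using that u v Zinj[of w u] LZ[of w] by auto
    have "nbrs F v = {\<phi> v, u}"
      using u v uniq unfolding nF by auto
    then show ?thesis using u by blast
  qed
  have cL: "card (nbrs F v) = 1" if "v \<in> L" for v using nL[OF that] by simp
  have cC: "card (nbrs F v) \<in> {1, 2}" if "v \<in> C" for v
  proof -
    have "finite (nbrs F v)" "nbrs F v \<noteq> {}"
      using nC[OF that] C[OF that] fin V by auto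
    then have "card (nbrs F v) > 0" by (simp add: card_gt_0_iff)
    moreover have "card (nbrs F v) \<le> card {w \<in> V. \<phi> w = v}"
      using nC[OF that] fin V by (intro card_mono) auto
    ultimately show ?thesis using fibre[of v] by auto
  qed
  have cZ: "card (nbrs F v) = (if \<phi> (\<phi> v) = v then 1 else 2)" if v: "v \<in> Z" for v
  proof -
    obtain u where u: "u \<in> Z" "\<phi> u = v" "nbrs F v = {\<phi> v, u}" using pred[OF v] by blast
    have "\<phi> v = u \<longleftrightarrow> \<phi> (\<phi> v) = v" using u Zinj ZZ v by metis
    then show ?thesis using u by (auto simp: card_insert_if)
  qed
  have out: "v \<in> V" if "nbrs F v \<noteq> {}" for v
    using that maps V unfolding nF by auto
  show thesis
  proof (rule that[of F])
    show "F \<subseteq> (\<lambda>v. {v, \<phi> v}) ` V" unfolding F_def V by auto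
    show "{v, \<phi> v} \<in> F" if "v \<in> V" "\<forall>u\<in>V. \<phi> u \<noteq> v" for v
    proof -
      have "v \<notin> C" using C[of v] that(2) V by blast
      then show ?thesis using that(1) V unfolding F_def by blast
    qed
    show "card (nbrs F v) \<in> {1, 2}" if "v \<in> V" for v
      using that cL[of v] cC[of v] cZ[of v] V by (auto split: if_splits)
    fix v u w assume v: "card (nbrs F v) = 2" and uw: "u \<in> nbrs F v" "w \<in> nbrs F v"
    have "v \<in> V" using out[of v] v by (metis card.empty zero_neq_numeral)
    moreover have "v \<notin> L" using cL v by force
    ultimately consider "v \<in> C" | "v \<in> Z" using V by blast
    then show "card (nbrs F u) = card (nbrs F w)"
    proof cases
      case 1
      then show ?thesis using nC[OF 1] uw cL by simp
    next
      case 2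
      have turn: "\<phi> (\<phi> v) \<noteq> v" using cZ[OF 2] v by (auto split: if_splits)
      have "card (nbrs F a) = 2" if a: "a \<in> nbrs F v" for a
      proof -
        obtain b where b: "b \<in> Z" "\<phi> b = v" "nbrs F v = {\<phi> v, b}" using pred[OF 2] by blast
        then have "a \<in> Z" using a ZZ[OF 2] by auto
        moreover have "\<phi> (\<phi> a) \<noteq> a"
        proof
          assume eq: "\<phi> (\<phi> a) = a"
          consider "a = \<phi> v" | "a = b" using a b by blast
          then show False
          proof cases
            case 1
            then have "\<phi> (\<phi> v) = v" using eq Zinj 2 ZZ by metis
            then show False using turn by blast
          next
            case 2
            then show False using eq b turn by simp
          qed
        qed
        ultimately show ?thesis using cZ by simp
      qed
      then show ?thesis using uw by simp
    qed
  qed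
qed

section \<open>Components of stars and circuits\<close>

text \<open>The subgraph induced on the vertices reachable from \<open>v\<close> is connected and
  contains \<open>C\<close>, so maximality makes it equal to \<open>C\<close>.\<close>

lemma graph_component_reachable:
  assumes F: "simple_graph F" and C: "graph_component C F" and v: "v \<in> verts C"
  shows "verts C = {(x, y). {x, y} \<in> edges F}\<^sup>* `` {v}"
    and "edges C = {e \<in> edges F. e \<subseteq> verts C}"
proof -
  define R where "R = {(x, y). {x, y} \<in> edges F}"
  define W where "W = R\<^sup>* `` {v}"
  define H :: "'a ugraph" where "H = \<lparr>verts = W, edges = {e \<in> edges F. e \<subseteq> W}\<rparr>"
  define RH where "RH = {(x, y). {x, y} \<in> edges H}"
  have CF: "subgraph C F" "connected_graph C" using C unfolding graph_component_def by auto
  have symR: "sym (RH\<^sup>*)"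
    by (intro sym_rtrancl) (auto simp: sym_def RH_def insert_commute)
  have vF: "v \<in> verts F" using v CF unfolding subgraph_def by auto
  have "w \<in> verts F" if "(v, w) \<in> R\<^sup>*" for w
    using that vF F by (induction rule: rtrancl_induct) (auto simp: R_def simple_graph_def)
  then have WF: "W \<subseteq> verts F" unfolding W_def by auto
  have H: "simple_graph H"
    using F WF unfolding simple_graph_def H_def by (auto intro: finite_subset)
  have reach: "(v, w) \<in> RH\<^sup>*" if "(v, w) \<in> R\<^sup>*" for w
    using that
  proof (induction rule: rtrancl_induct)
    case (step a b)
    then have "(v, b) \<in> R\<^sup>*" by simp
    then have "a \<in> W" "b \<in> W" using step(1) unfolding W_def by auto
    then have "(a, b) \<in> RH" using step(2) unfolding RH_def H_def R_def by simp
    then show ?case using step.IH by simp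
  qed simp
  have "connected_graph H"
    unfolding connected_graph_def RH_def[symmetric]
  proof (intro conjI ballI)
    show "verts H \<noteq> {}" unfolding H_def W_def by auto
    fix a b assume "a \<in> verts H" "b \<in> verts H"
    then have "(v, a) \<in> RH\<^sup>*" "(v, b) \<in> RH\<^sup>*" using reach unfolding H_def W_def by auto
    then show "(a, b) \<in> RH\<^sup>*" using symR by (meson rtrancl_trans symD)
  qed
  moreover have "subgraph H F"
    using H F WF unfolding subgraph_def H_def by auto
  moreover have CW: "verts C \<subseteq> W"
  proof
    fix w assume "w \<in> verts C"
    then have "(v, w) \<in> {(x, y). {x, y} \<in> edges C}\<^sup>*"
      using CF(2) v unfolding connected_graph_def by blast
    moreover have "{(x, y). {x, y} \<in> edges C} \<subseteq> R"
      using CF(1) unfolding subgraph_def R_def by auto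
    ultimately show "w \<in> W" using rtrancl_mono unfolding W_def by blast
  qed
  then have "subgraph C H"
    using CF(1) H unfolding subgraph_def H_def simple_graph_def by fastforce
  ultimately have "H = C" using C unfolding graph_component_def by blast
  then show "verts C = {(x, y). {x, y} \<in> edges F}\<^sup>* `` {v}"
    and "edges C = {e \<in> edges F. e \<subseteq> verts C}"
    unfolding H_def W_def R_def by auto
qed

lemma star_circuit_component:
  assumes F: "simple_graph F" and deg: "\<And>v. v \<in> verts F \<Longrightarrow> card (nbrs (edges F) v) \<in> {1, 2}"
    and same: "\<And>v u w. card (nbrs (edges F) v) = 2 \<Longrightarrow> u \<in> nbrs (edges F) v \<Longrightarrow>
       w \<in> nbrs (edges F) v \<Longrightarrow> card (nbrs (edges F) u) = card (nbrs (edges F) w)"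
    and C: "graph_component C F"
  shows "graph_iso C (star_graph 1) \<or> graph_iso C (star_graph 2) \<or> (\<exists>m\<ge>3. circuit m C)"
proof -
  let ?n = "nbrs (edges F)"
  let ?R = "{(x, y). {x, y} \<in> edges F}"
  have CF: "subgraph C F" "connected_graph C" using C unfolding graph_component_def by auto
  have two: "card e = 2" if "e \<in> edges F" for e using F that unfolding simple_graph_def by blast
  have nbrs_neq: "u \<noteq> v" if "u \<in> ?n v" for u v
    using two[of "{u, v}"] that by (auto simp: nbrs_def)
  have Csub: "verts C \<subseteq> verts F" using CF unfolding subgraph_def by blast
  have Cdeg: "card (?n v) \<in> {1, 2}" if "v \<in> verts C" for v using deg Csub that by blast
  note reach = graph_component_reachable[OF F C]
  have closed: "u \<in> verts C" if "v \<in> verts C" "u \<in> ?n v" for u v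
  proof -
    have "(v, u) \<in> ?R" using that(2) by (simp add: nbrs_def insert_commute)
    then show ?thesis using reach(1)[OF that(1)] by blast
  qed
  \<comment> \<open>To bound a component from above, it suffices to find a set closed under
    adjacency that contains one of its vertices.\<close>
  have into: "verts C \<subseteq> S"
    if "v \<in> verts C" "v \<in> S" "\<And>a b. a \<in> S \<Longrightarrow> b \<in> ?n a \<Longrightarrow> b \<in> S" for v S
  proof
    fix w assume "w \<in> verts C"
    then have "(v, w) \<in> ?R\<^sup>*" using reach(1)[OF that(1)] by blast
    then show "w \<in> S"
      using that(2,3) by (induction rule: rtrancl_induct) (auto simp: nbrs_def insert_commute)
  qed
  have edge: "e \<in> edges C \<longleftrightarrow> (\<exists>v\<in>verts C. \<exists>u\<in>?n v. e = {v, u})" for e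
  proof
    assume e: "e \<in> edges C"
    obtain v0 where "v0 \<in> verts C" using CF(2) unfolding connected_graph_def by blast
    then have eF: "e \<in> edges F" "e \<subseteq> verts C" using reach(2) e by auto
    then obtain a b where "e = {a, b}" using two by (meson card_2_iff)
    then show "\<exists>v\<in>verts C. \<exists>u\<in>?n v. e = {v, u}"
      using eF by (auto simp: nbrs_def insert_commute)
  next
    assume "\<exists>v\<in>verts C. \<exists>u\<in>?n v. e = {v, u}"
    then obtain v u where vu: "v \<in> verts C" "u \<in> ?n v" "e = {v, u}" by blast
    then show "e \<in> edges C"
      using reach(2)[OF vu(1)] closed[OF vu(1,2)] by (simp add: nbrs_def insert_commute)
  qed
  have star2: ?thesis if v: "v \<in> verts C" "card (?n v) = 2" "\<And>u. u \<in> ?n v \<Longrightarrow> card (?n u) = 1" for v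
  proof -
    obtain a b where ab: "?n v = {a, b}" "a \<noteq> b" using v(2) by (meson card_2_iff)
    have na: "?n u = {v}" if "u \<in> ?n v" for u
      using v(3)[OF that] that nbrs_sym[of u "edges F" v] by (auto simp: card_1_singleton_iff)
    have nab: "?n a = {v}" "?n b = {v}" using na ab by auto
    have neq: "a \<noteq> v" "b \<noteq> v" using nab ab by auto
    have "verts C \<subseteq> {v, a, b}"
      by (rule into[OF v(1)]) (use nab ab in auto)
    then have VC: "verts C = {v, a, b}" using closed[OF v(1)] v(1) ab by auto
    have EC: "edges C = {{v, a}, {v, b}}"
      by (auto simp: set_eq_iff edge VC nab ab)
    let ?f = "\<lambda>x. if x = v then 0 else if x = a then 1 else 2 :: nat"
    have "bij_betw ?f (verts C) (verts (star_graph 2))"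
      unfolding VC bij_betw_def star_graph_def using neq ab(2)
      by (auto simp: numeral_2_eq_2 atLeast0_atMost_Suc)
    moreover have "edges (star_graph 2) = {{0, 1}, {0, 2}}"
      unfolding star_graph_def by (auto simp: numeral_2_eq_2 le_Suc_eq)
    then have "edges (star_graph 2) = (\<lambda>e. ?f ` e) ` edges C"
      unfolding EC using neq ab(2) by (simp add: insert_commute)
    ultimately show ?thesis unfolding graph_iso_def by blast
  qed
  have star1: ?thesis if v: "v \<in> verts C" "?n v = {u}" "card (?n u) = 1" for u v
  proof -
    have nu: "?n u = {v}"
      using v nbrs_sym[of u "edges F" v] by (auto simp: card_1_singleton_iff)
    have neq: "u \<noteq> v" using nbrs_neq[of u v] v(2) by simp
    have "verts C \<subseteq> {v, u}"
      by (rule into[OF v(1)]) (use nu v in auto)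
    then have VC: "verts C = {v, u}" using closed[OF v(1)] v by auto
    have EC: "edges C = {{v, u}}"
      by (auto simp: set_eq_iff edge VC nu v)
    let ?f = "\<lambda>x. if x = v then 0 else 1 :: nat"
    have "bij_betw ?f (verts C) (verts (star_graph 1))"
      unfolding VC bij_betw_def star_graph_def using neq by auto
    moreover have "edges (star_graph 1) = {{0, 1}}"
      unfolding star_graph_def by auto
    then have "edges (star_graph 1) = (\<lambda>e. ?f ` e) ` edges C"
      unfolding EC using neq by (simp add: insert_commute)
    ultimately show ?thesis unfolding graph_iso_def by blast
  qed
  obtain v where v: "v \<in> verts C" using CF(2) unfolding connected_graph_def by blast
  have regular: ?thesis if v2: "card (?n v) = 2" and u2: "\<And>u. u \<in> ?n v \<Longrightarrow> card (?n u) = 2"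
  proof -
    \<comment> \<open>Degree 2 alone need not pass to neighbours; together with degree 2 at all
      neighbours it does, by \<open>same\<close>.\<close>
    define S where "S = {a. card (?n a) = 2 \<and> (\<forall>u\<in>?n a. card (?n u) = 2)}"
    have "verts C \<subseteq> S"
    proof (rule into[OF v])
      show "v \<in> S" using v2 u2 unfolding S_def by simp
      fix a b assume a: "a \<in> S" and b: "b \<in> ?n a"
      have "card (?n b) = 2" "card (?n a) = 2" using a b unfolding S_def by auto
      moreover have "card (?n u) = card (?n a)" if "u \<in> ?n b" for u
        using same[of b u a] calculation that b nbrs_sym[of a] by blast
      ultimately show "b \<in> S" unfolding S_def by auto
    qed
    moreover have "?n w = nbrs (edges C) w" if "w \<in> verts C" for w
      using reach(2)[OF v] closed[OF that] that by (auto simp: nbrs_def)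
    moreover have "vdegree C w = card (nbrs (edges C) w)" for w
      unfolding vdegree_def using two reach(2)[OF v] by (intro card_incident) auto
    ultimately have "\<forall>w\<in>verts C. vdegree C w = 2" unfolding S_def by auto
    moreover have "3 \<le> card (verts C)"
    proof -
      obtain a b where ab: "?n v = {a, b}" "a \<noteq> b" using v2 by (meson card_2_iff)
      then have "a \<in> ?n v" "b \<in> ?n v" by simp_all
      then have "v \<noteq> a" "v \<noteq> b" using nbrs_neq by blast+
      then have "card {v, a, b} = 3" using ab by simp
      moreover have "{v, a, b} \<subseteq> verts C" using closed[OF v] v ab by auto
      moreover have "finite (verts C)"
        using F Csub finite_subset unfolding simple_graph_def by blast
      ultimately show ?thesis by (metis card_mono)
    qed
    ultimately show ?thesis
      using CF unfolding circuit_def subgraph_def by auto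
  qed
  show ?thesis
  proof (cases "card (?n v) = 1")
    case True
    then obtain u where u: "?n v = {u}" by (auto simp: card_1_singleton_iff)
    show ?thesis
    proof (cases "card (?n u) = 1")
      case False
      have uC: "u \<in> verts C" using closed[OF v] u by simp
      then have "card (?n u) = 2" using False Cdeg by auto
      moreover have "v \<in> ?n u" using u nbrs_sym[of u "edges F" v] by simp
      ultimately show ?thesis using star2[OF uC] same[of u _ v] True by metis
    qed (rule star1[OF v u])
  next
    case False
    then have dv: "card (?n v) = 2" using Cdeg v by auto
    then obtain a where a: "a \<in> ?n v" by fastforce
    have eq: "card (?n u) = card (?n a)" if "u \<in> ?n v" for u using same[OF dv that a] .
    show ?thesis
    proof (cases "card (?n a) = 1")
      case True
      then show ?thesis using star2[OF v dv] eq by simp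
    next
      case False
      then have "card (?n a) = 2" using Cdeg closed[OF v a] by auto
      then show ?thesis using regular[OF dv] eq by simp
    qed
  qed
qed

section \<open>Expansion from the adjacency lemma\<close>

text \<open>Since \<open>1 / d \<ge> 1 / k\<close>, the worst case is \<open>s = d - 1\<close> and
  \<open>s + t = m\<close>. Substituting these values leaves exactly the inequality
  \<open>key\<close>. In \<open>nbr_weight\<close>, \<open>s\<close> and \<open>t\<close> count the
  senders of degree below \<open>k\<close> and equal to \<open>k\<close>, and \<open>d\<close> is
  their least degree.\<close>

lemma weight_bound:
  fixes s t d k m :: real
  assumes "0 < d" "d \<le> k" "s + 1 \<le> d" "s + t \<le> m" and key: "3 * d \<le> k + d * d"
  shows "s / d + t / k \<le> 2 - 2 / k - (k - m) / k"
proof -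
  have "s / d + t / k = s * (1 / d - 1 / k) + (s + t) / k"
    by (simp add: algebra_simps add_divide_distrib)
  also have "\<dots> \<le> (d - 1) * (1 / d - 1 / k) + m / k"
    using assms by (intro add_mono mult_right_mono divide_right_mono) (auto simp: frac_le)
  also have "\<dots> = 1 - (k + d * d) / (d * k) + 1 / k + m / k"
    using assms by (simp add: field_simps)
  also have "\<dots> \<le> 1 - (3 * d) / (d * k) + 1 / k + m / k"
    using assms by (intro add_mono diff_mono divide_right_mono) auto
  also have "\<dots> = 2 - 2 / k - (k - m) / k"
    using assms by (simp add: field_simps)
  finally show ?thesis .
qed

locale vizing_adjacency =
  fixes E :: "'a set set" and k :: nat
  assumes fin: "finite E" and two: "\<And>e. e \<in> E \<Longrightarrow> card e = 2" and k: "2 \<le> k"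
    and deg: "\<And>v. card (nbrs E v) \<le> k"
    and adj: "\<And>x y. {x, y} \<in> E \<Longrightarrow>
      k + 1 \<le> card (nbrs E y) + card {z \<in> nbrs E x. z \<noteq> y \<and> card (nbrs E z) = k}"
begin

abbreviation "d v \<equiv> card (nbrs E v)"

lemma finite_nbrs: "finite (nbrs E v)"
  using fin two by (rule Submission.finite_nbrs)

lemma edge_iff: "{x, y} \<in> E \<longleftrightarrow> y \<in> nbrs E x"
  by (simp add: nbrs_def insert_commute)

lemma degree_ge_2:
  assumes "nbrs E v \<noteq> {}"
  shows "2 \<le> d v"
proof -
  obtain s where s: "s \<in> nbrs E v" using assms by blast
  have "card {z \<in> nbrs E v. z \<noteq> s \<and> d z = k} \<noteq> 0"
    using adj[of v s] s deg[of s] by (simp add: edge_iff)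
  then have "{z \<in> nbrs E v. z \<noteq> s \<and> d z = k} \<noteq> {}" by (metis card.empty)
  then obtain z where "z \<in> nbrs E v" "z \<noteq> s" by blast
  then have "card {z, s} \<le> d v" using s finite_nbrs by (intro card_mono) auto
  then show ?thesis using \<open>z \<noteq> s\<close> by simp
qed

text \<open>By adjacency \<open>s\<close> has at least \<open>k + 1 - d v\<close> neighbours of
  degree \<open>k\<close>, and it has at most \<open>k\<close> neighbours in all.\<close>

lemma card_minor_nbrs:
  assumes "v \<in> nbrs E s"
  shows "card {z \<in> nbrs E s. d z < k} + 1 \<le> d v"
proof -
  have "d s = card ({z \<in> nbrs E s. d z < k} \<union> {z \<in> nbrs E s. d z = k})"
    using deg by (intro arg_cong[where f = card]) (auto simp: nat_less_le)
  also have "\<dots> = card {z \<in> nbrs E s. d z < k} + card {z \<in> nbrs E s. d z = k}"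
    using finite_nbrs by (intro card_Un_disjoint) auto
  finally have "card {z \<in> nbrs E s. d z < k} + card {z \<in> nbrs E s. d z = k} \<le> k"
    using deg[of s] by simp
  moreover have "card {z \<in> nbrs E s. z \<noteq> v \<and> d z = k} \<le> card {z \<in> nbrs E s. d z = k}"
    using finite_nbrs by (intro card_mono) auto
  ultimately show ?thesis using adj[of s v] assms by (simp add: edge_iff)
qed

text \<open>This bounds the charge that \<open>s\<close> receives from its neighbours in
  \<open>T\<close>. With d the least degree in \<open>T\<close>, at most d - 1 senders have degree
  below \<open>k\<close>, each giving at most 1/d; the others give 1/k. A neighbour outside
  \<open>T\<close> forces \<open>m < k\<close>, which makes the slack \<open>(k - m) / k\<close>
  positive.\<close>

lemma nbr_weight:
  assumes T: "T \<subseteq> nbrs E s" "T \<noteq> {}" and D: "\<And>v. v \<in> T \<Longrightarrow> d v \<le> D" "D \<le> k" "2 \<le> D"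
  shows "(\<Sum>v\<in>T. 1 / real (d v)) \<le> 2 - 2 / D"
    and "T \<noteq> nbrs E s \<Longrightarrow> (\<Sum>v\<in>T. 1 / real (d v)) < 2 - 2 / D"
proof -
  have finT: "finite T" using T finite_nbrs finite_subset by blast
  obtain v where v: "v \<in> T" and vmin: "\<And>w. w \<in> T \<Longrightarrow> d v \<le> d w"
    using arg_min_if_finite[OF finT T(2), of d] by (metis not_le)
  define m where "m = card T"
  define A where "A = {w \<in> T. d w < k}"
  define B where "B = {w \<in> T. d w = k}"
  have TAB: "T = A \<union> B" "A \<inter> B = {}" using deg unfolding A_def B_def by (auto simp: nat_less_le)
  have finAB: "finite A" "finite B" using finT unfolding A_def B_def by auto
  have "card A \<le> card {z \<in> nbrs E s. d z < k}"
    using T finite_nbrs unfolding A_def by (intro card_mono) auto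
  then have cA: "card A + 1 \<le> d v" using card_minor_nbrs[of v s] v T by auto
  have mAB: "card A + card B = m"
    unfolding m_def using TAB finAB card_Un_disjoint by metis
  have mk: "m \<le> d s" unfolding m_def using T finite_nbrs by (intro card_mono) auto
  have dv: "2 \<le> d v" using T v nbrs_sym[of v E s] by (intro degree_ge_2) auto
  have "(\<Sum>w\<in>T. 1 / real (d w)) = (\<Sum>w\<in>A. 1 / real (d w)) + (\<Sum>w\<in>B. 1 / real (d w))"
    using TAB finAB by (simp add: sum.union_disjoint)
  also have "(\<Sum>w\<in>A. 1 / real (d w)) \<le> (\<Sum>w\<in>A. 1 / real (d v))"
    using vmin dv unfolding A_def by (intro sum_mono frac_le) auto
  also have "(\<Sum>w\<in>B. 1 / real (d w)) = (\<Sum>w\<in>B. 1 / real k)"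
    unfolding B_def by (intro sum.cong) auto
  finally have le: "(\<Sum>w\<in>T. 1 / real (d w)) \<le> real (card A) / d v + real (card B) / k"
    by simp
  have "(\<Sum>v\<in>T. 1 / real (d v)) \<le> 2 - 2 / D \<and>
    (T \<noteq> nbrs E s \<longrightarrow> (\<Sum>v\<in>T. 1 / real (d v)) < 2 - 2 / D)"
  proof (cases "D = k")
    case True
    have *: "(\<Sum>w\<in>T. 1 / real (d w)) \<le> 2 - 2 / D - (real k - real m) / k"
    proof -
      \<comment> \<open>For \<open>d v \<ge> 3\<close> the square suffices; for
        \<open>d v = 2\<close> this is precisely \<open>2 \<le> k\<close>.\<close>
      have "3 * d v \<le> k + d v * d v"
      proof (cases "d v = 2")
        case False
        then have "3 \<le> d v" using dv by simp
        then show ?thesis by (intro trans_le_add2 mult_right_mono) simp_all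
      qed (use k in simp)
      then have "3 * real (d v) \<le> real k + real (d v) * real (d v)"
        by (metis of_nat_add of_nat_le_iff of_nat_mult of_nat_numeral)
      then have "real (card A) / d v + real (card B) / k \<le> 2 - 2 / k - (real k - real m) / k"
        using cA mAB dv deg[of v] by (intro weight_bound) auto
      then show ?thesis using le True by simp
    qed
    moreover have "(real k - real m) / k \<ge> 0" using mk deg[of s] by simp
    moreover have "(real k - real m) / k > 0" if "T \<noteq> nbrs E s"
    proof -
      have "m < d s" unfolding m_def using that T finite_nbrs by (intro psubset_card_mono) auto
      then show ?thesis using deg[of s] k by simp
    qed
    ultimately show ?thesis by fastforce
  next
    case False
    \<comment> \<open>All senders now have degree below \<open>k\<close>, so the charge is at most
      \<open>1 - 1 / D\<close>, which is strictly below the bound for every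
      \<open>T\<close>.\<close>
    then have "B = {}" using D unfolding B_def by fastforce
    then have "(\<Sum>w\<in>T. 1 / real (d w)) \<le> real (card A) / d v" using le by simp
    also have "\<dots> \<le> (real (d v) - 1) / d v" using cA by (intro divide_right_mono) auto
    also have "\<dots> = 1 - 1 / d v" using dv by (simp add: field_simps)
    also have "\<dots> \<le> 1 - 1 / D" using dv D(1)[OF v] by (simp add: frac_le)
    also have "\<dots> < 2 - 2 / D" using D(3) by (simp add: field_simps)
    finally show ?thesis by simp
  qed
  then show "(\<Sum>v\<in>T. 1 / real (d v)) \<le> 2 - 2 / D"
    and "T \<noteq> nbrs E s \<Longrightarrow> (\<Sum>v\<in>T. 1 / real (d v)) < 2 - 2 / D" by blast+
qed

text \<open>The charges sum to \<open>card J\<close>. All neighbours of a vertex \<open>w\<close> of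
  largest degree lie in \<open>S\<close>, so the bound \<open>2 - 2 / d w\<close> at each vertex of
  \<open>S\<close> saves at least 2 in total. If one of these bounds is strict, integrality turns
  the strict total into a further 1.\<close>

lemma expansion:
  assumes J: "finite J" "J \<noteq> {}" "\<And>v. v \<in> J \<Longrightarrow> nbrs E v \<noteq> {}"
  defines "S \<equiv> \<Union>v\<in>J. nbrs E v"
  shows "card J + 2 \<le> 2 * card S"
    and "s \<in> S \<Longrightarrow> u \<in> nbrs E s \<Longrightarrow> u \<notin> J \<Longrightarrow> card J + 3 \<le> 2 * card S"
proof -
  obtain w where w: "w \<in> J" and wmax: "\<And>v. v \<in> J \<Longrightarrow> d v \<le> d w"
  proof -
    have "Max (d ` J) \<in> d ` J" using J by (intro Max_in) auto
    then obtain w where w: "Max (d ` J) = d w" "w \<in> J" by (rule imageE)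
    have "d v \<le> d w" if "v \<in> J" for v
      unfolding w(1)[symmetric] using J(1) that by (intro Max_ge) auto
    then show ?thesis using that w(2) by blast
  qed
  \<comment> \<open>Discharging: every \<open>v \<in> J\<close> sends the charge \<open>1 / d v\<close> to each of its neighbours.\<close>
  let ?T = "\<lambda>s. {v \<in> J. s \<in> nbrs E v}"
  have T: "?T s = nbrs E s \<inter> J" for s using nbrs_sym[of s E] by auto
  have finS: "finite S" unfolding S_def using J(1) finite_nbrs by blast
  have dw: "2 \<le> d w" using degree_ge_2 J(3) w by blast
  have wS: "d w \<le> card S" unfolding S_def using w finS S_def by (intro card_mono) auto
  have dpos: "0 < d v" if "v \<in> J" for v using degree_ge_2[OF J(3)[OF that]] by simp
  have "real (card J) = (\<Sum>v\<in>J. \<Sum>s\<in>{s. s \<in> S \<and> s \<in> nbrs E v}. 1 / real (d v))"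
  proof -
    have "(\<Sum>s\<in>{s. s \<in> S \<and> s \<in> nbrs E v}. 1 / real (d v)) = 1" if "v \<in> J" for v
    proof -
      have "{s. s \<in> S \<and> s \<in> nbrs E v} = nbrs E v" using that unfolding S_def by auto
      then show ?thesis using dpos[OF that] by simp
    qed
    then have "(\<Sum>v\<in>J. \<Sum>s\<in>{s. s \<in> S \<and> s \<in> nbrs E v}. 1 / real (d v)) = (\<Sum>v\<in>J. 1)"
      by (rule sum.cong[OF refl])
    then show ?thesis by (simp only: sum_constant mult_1_right)
  qed
  also have "\<dots> = (\<Sum>s\<in>S. \<Sum>v\<in>?T s. 1 / real (d v))"
    by (rule sum.swap_restrict[OF J(1) finS])
  finally have cJ: "real (card J) = (\<Sum>s\<in>S. \<Sum>v\<in>?T s. 1 / real (d v))" .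
  have bound: "(\<Sum>v\<in>?T s. 1 / real (d v)) \<le> 2 - 2 / d w"
    and strict: "\<exists>u\<in>nbrs E s. u \<notin> J \<Longrightarrow> (\<Sum>v\<in>?T s. 1 / real (d v)) < 2 - 2 / d w"
    if "s \<in> S" for s
  proof -
    have ne: "?T s \<noteq> {}" using that unfolding S_def by auto
    note nw = nbr_weight[of "?T s" s "d w", OF _ ne wmax deg dw]
    show "(\<Sum>v\<in>?T s. 1 / real (d v)) \<le> 2 - 2 / d w" by (rule nw(1)) (auto simp: T)
    assume "\<exists>u\<in>nbrs E s. u \<notin> J"
    then show "(\<Sum>v\<in>?T s. 1 / real (d v)) < 2 - 2 / d w" by (intro nw(2)) (auto simp: T)
  qed
  have total: "(\<Sum>s\<in>S. 2 - 2 / real (d w)) \<le> 2 * real (card S) - 2"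
  proof -
    have "1 \<le> real (card S) / d w" using wS dw by (simp add: field_simps)
    moreover have "(\<Sum>s\<in>S. 2 - 2 / real (d w)) = 2 * real (card S) - 2 * (real (card S) / d w)"
      by (simp add: algebra_simps)
    ultimately show ?thesis by linarith
  qed
  have "real (card J) \<le> 2 * real (card S) - 2"
    unfolding cJ using sum_mono[OF bound] total by (rule order_trans)
  then show "card J + 2 \<le> 2 * card S" by linarith
  assume s: "s \<in> S" "u \<in> nbrs E s" "u \<notin> J"
  have "(\<Sum>s\<in>S. \<Sum>v\<in>?T s. 1 / real (d v)) < (\<Sum>s\<in>S. 2 - 2 / real (d w))"
    using finS bound s(1) strict[OF s(1)] s by (intro sum_strict_mono_ex1) auto
  then have "real (card J) < 2 * real (card S) - 2" using cJ total by linarith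
  then show "card J + 3 \<le> 2 * card S" by linarith
qed

end

section \<open>Critical graphs\<close>

lemma edge_chromatic_number_le:
  assumes "proper_colouring (edges H) k c"
  shows "edge_chromatic_number H \<le> k"
proof -
  let ?M = "(\<lambda>\<alpha>. {e \<in> edges H. c e = \<alpha>}) ` {..<k}"
  have "edge_chromatic_number H \<le> card ?M"
    unfolding edge_chromatic_number_def
  proof (rule Least_le, intro exI conjI ballI)
    show "graph_matching H M" if "M \<in> ?M" for M
      using that assms unfolding graph_matching_def pairwise_def disjnt_def proper_colouring_def
      by auto
    show "edges H \<subseteq> \<Union>?M" using assms unfolding proper_colouring_def by auto
  qed auto
  also have "\<dots> \<le> k" using card_image_le[of "{..<k}"] by simp
  finally show ?thesis .
qed

lemma proper_colouring_exists:
  assumes H: "simple_graph H" and le: "edge_chromatic_number H \<le> k"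
  shows "\<exists>c. proper_colouring (edges H) k c"
proof -
  have "edges H \<subseteq> Pow (verts H)" using H unfolding simple_graph_def by auto
  then have fin: "finite (edges H)"
    using H finite_subset unfolding simple_graph_def by blast
  let ?Q = "\<lambda>n \<M>. finite \<M> \<and> card \<M> = n \<and> (\<forall>M\<in>\<M>. graph_matching H M) \<and> edges H \<subseteq> \<Union>\<M>"
  \<comment> \<open>The cover by single edges shows that the \<open>LEAST\<close> in the definition
    is attained.\<close>
  have "?Q (card ((\<lambda>e. {e}) ` edges H)) ((\<lambda>e. {e}) ` edges H)"
    using fin unfolding graph_matching_def by auto
  then have "\<exists>n. \<exists>\<M>. ?Q n \<M>" by blast
  then have "\<exists>\<M>. ?Q (edge_chromatic_number H) \<M>"
    unfolding edge_chromatic_number_def by (rule LeastI_ex)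
  then obtain \<M> where M: "finite \<M>" "card \<M> = edge_chromatic_number H"
    "\<And>M. M \<in> \<M> \<Longrightarrow> graph_matching H M" "edges H \<subseteq> \<Union>\<M>" by blast
  \<comment> \<open>The matchings of a cover may overlap, so \<open>g\<close> picks one for each
    edge; \<open>h\<close> numbers the matchings.\<close>
  obtain h where h: "bij_betw h \<M> {0..<card \<M>}"
    using ex_bij_betw_finite_nat[OF M(1)] by blast
  have "\<forall>e\<in>edges H. \<exists>M. M \<in> \<M> \<and> e \<in> M" using M(4) by blast
  then obtain g where g: "\<And>e. e \<in> edges H \<Longrightarrow> g e \<in> \<M> \<and> e \<in> g e"
    by metis
  have "proper_colouring (edges H) k (h \<circ> g)"
  proof (rule proper_colouringI)
    fix e assume "e \<in> edges H"
    then have "h (g e) \<in> {0..<card \<M>}" using g bij_betw_apply[OF h] by blast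
    then show "(h \<circ> g) e < k" using M(2) le by simp
  next
    fix e f v assume ef: "e \<in> edges H" "f \<in> edges H" "e \<noteq> f" "v \<in> e" "v \<in> f"
    show "(h \<circ> g) e \<noteq> (h \<circ> g) f"
    proof
      assume "(h \<circ> g) e = (h \<circ> g) f"
      then have "g e = g f" using g ef(1,2) bij_betw_imp_inj_on[OF h] by (simp add: inj_on_eq_iff)
      then have "e \<in> g e" "f \<in> g e" "graph_matching H (g e)" using g[OF ef(1)] g[OF ef(2)] M(3) by auto
      then show False using ef(3-) unfolding graph_matching_def pairwise_def disjnt_def by blast
    qed
  qed
  then show ?thesis by blast
qed

lemma k_critical_vizing_adjacency:
  assumes G: "k_critical k G" and k: "2 \<le> k"
  shows "vizing_adjacency (edges G) k"
proof -
  have sG: "simple_graph G" and D: "max_degree G = k" and chi: "edge_chromatic_number G = k + 1"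
    and crit: "\<And>H. subgraph H G \<Longrightarrow> H \<noteq> G \<Longrightarrow> edge_chromatic_number H \<le> k"
    using G unfolding k_critical_def by auto
  have two: "card e = 2" "e \<subseteq> verts G" if "e \<in> edges G" for e
    using sG that unfolding simple_graph_def by auto
  have "edges G \<subseteq> Pow (verts G)" using two by auto
  then have fin: "finite (edges G)"
    using sG finite_subset unfolding simple_graph_def by blast
  have unc: "\<nexists>c. proper_colouring (edges G) k c"
    using edge_chromatic_number_le[of G k] chi by fastforce
  have deg: "card (nbrs (edges G) v) \<le> k" for v
  proof (cases "v \<in> verts G")
    case True
    have "card (nbrs (edges G) v) = vdegree G v"
      unfolding vdegree_def using two by (intro card_incident[symmetric]) auto
    also have "\<dots> \<le> max_degree G"
      using True sG unfolding max_degree_def simple_graph_def by (intro Max_ge) auto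
    finally show ?thesis using D by simp
  next
    case False
    then have "nbrs (edges G) v = {}" using two(2) unfolding nbrs_def by auto
    then show ?thesis by simp
  qed
  show ?thesis
  proof
    fix x y assume xy: "{x, y} \<in> edges G"
    let ?H = "\<lparr>verts = verts G, edges = edges G - {{x, y}}\<rparr>"
    have sH: "simple_graph ?H" using sG unfolding simple_graph_def by auto
    have "?H \<noteq> G" using xy by (metis DiffE insertI1 ugraph.select_convs(2))
    then have "edge_chromatic_number ?H \<le> k"
      using crit sH sG unfolding subgraph_def by simp
    then obtain c where "proper_colouring (edges G - {{x, y}}) k c"
      using proper_colouring_exists[OF sH] by auto
    then interpret uncolourable_edge "edges G" k c x y
      using unc two(1) xy by (intro uncolourable_edge.intro)
    show "k + 1 \<le> card (nbrs (edges G) y) +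
        card {z \<in> nbrs (edges G) x. z \<noteq> y \<and> card (nbrs (edges G) z) = k}"
      by (rule adjacency[OF fin deg])
  qed (use fin two k deg in auto)
qed

text \<open>Deleting an isolated vertex would give a proper subgraph with the same edges, hence
  still with edge-chromatic number \<open>k + 1\<close>.\<close>

lemma k_critical_no_isolated:
  assumes G: "k_critical k G" and v: "v \<in> verts G"
  shows "nbrs (edges G) v \<noteq> {}"
proof
  assume iso: "nbrs (edges G) v = {}"
  have sG: "simple_graph G" and chi: "edge_chromatic_number G = k + 1"
    and crit: "\<And>H. subgraph H G \<Longrightarrow> H \<noteq> G \<Longrightarrow> edge_chromatic_number H \<le> k"
    using G unfolding k_critical_def by auto
  let ?H = "\<lparr>verts = verts G - {v}, edges = edges G\<rparr>"
  have "v \<notin> e" if e: "e \<in> edges G" for e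
  proof
    assume "v \<in> e"
    moreover have "card e = 2" using sG e unfolding simple_graph_def by blast
    ultimately obtain u where "e = {u, v}" by (auto simp: card_2_iff)
    then show False using iso e unfolding nbrs_def by blast
  qed
  then have "subgraph ?H G" using sG unfolding subgraph_def simple_graph_def by auto
  moreover have "?H \<noteq> G" using v by (metis DiffE insertI1 ugraph.select_convs(1))
  ultimately have "edge_chromatic_number ?H \<le> k" using crit by blast
  moreover have "edge_chromatic_number ?H = edge_chromatic_number G"
    unfolding edge_chromatic_number_def graph_matching_def by simp
  ultimately show False using chi by simp
qed

theorem theorem3p5:
  fixes G :: "'a ugraph" and e :: "'a set"
  assumes "critical G" and "e \<in> edges G"
  shows "\<exists>F. star_circuit_factor G F \<and> e \<in> edges F"
proof -
  obtain k where crit: "2 \<le> k" "k_critical k G" using assms(1) unfolding critical_def by blast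
  interpret vizing_adjacency "edges G" k using k_critical_vizing_adjacency[OF crit(2,1)] .
  have sG: "simple_graph G" using crit(2) unfolding k_critical_def by blast
  then have finV: "finite (verts G)" and sub: "\<And>e. e \<in> edges G \<Longrightarrow> e \<subseteq> verts G"
    unfolding simple_graph_def by auto
  let ?n = "nbrs (edges G)"
  have nV: "?n v \<subseteq> verts G" for v using sub unfolding nbrs_def by auto
  obtain x y where e: "e = {x, y}" "x \<noteq> y" using two[OF assms(2)] by (auto simp: card_2_iff)
  have xV: "x \<in> verts G" and xy: "y \<in> ?n x" "x \<in> ?n y"
    using assms(2) sub e(1) by (auto simp: nbrs_def insert_commute)
  \<comment> \<open>These capacities force \<open>x\<close> to have no preimage and leave room for \<open>x\<close> itself to be mapped to \<open>y\<close>.\<close>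
  define c :: "'a \<Rightarrow> nat" where "c u = (if u = x then 0 else if u = y then 1 else 2)" for u
  have "\<exists>f. (\<forall>v\<in>verts G - {x}. f v \<in> ?n v) \<and> (\<forall>u. card {v \<in> verts G - {x}. f v = u} \<le> c u)"
  proof (rule hall_capacities)
    show "finite (verts G - {x})" using finV by simp
    fix J assume J: "J \<subseteq> verts G - {x}"
    define S where "S = (\<Union>v\<in>J. ?n v)"
    have finJ: "finite J" using J finV finite_subset by blast
    have finS: "finite S" using finJ finite_nbrs unfolding S_def by blast
    have "2 * card S = (\<Sum>u\<in>S. c u + (if x = u then 2 else 0) + (if y = u then 1 else 0))"
      using e(2) unfolding c_def by (subst sum.cong[OF refl, of _ _ "\<lambda>_. 2"]) auto
    then have cap: "2 * card S = (\<Sum>u\<in>S. c u) + (if x \<in> S then 2 else 0) + (if y \<in> S then 1 else 0)"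
      using finS by (simp add: sum.distrib)
    show "card J \<le> (\<Sum>u\<in>(\<Union>v\<in>J. ?n v). c u)"
    proof (cases "J = {}")
      case False
      have ne: "?n v \<noteq> {}" if "v \<in> J" for v
        using k_critical_no_isolated[OF crit(2)] J that by blast
      have "card J + 2 \<le> 2 * card S"
        unfolding S_def by (rule expansion(1)[OF finJ False ne])
      \<comment> \<open>Here \<open>x\<close> is the neighbour of \<open>y\<close> outside
        \<open>J\<close> that the sharper bound asks for.\<close>
      moreover have "card J + 3 \<le> 2 * card S" if "y \<in> S"
        unfolding S_def
        by (rule expansion(2)[OF finJ False ne _ xy(2)]) (use that J in \<open>auto simp: S_def\<close>)
      ultimately show ?thesis using cap unfolding S_def[symmetric] by (auto split: if_splits)
    qed simp
  qed (rule finite_nbrs)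
  then obtain f where f: "\<And>v. v \<in> verts G - {x} \<Longrightarrow> f v \<in> ?n v"
    and fc: "\<And>u. card {v \<in> verts G - {x}. f v = u} \<le> c u" by blast
  define \<phi> where "\<phi> = f(x := y)"
  have \<phi>n: "\<phi> v \<in> ?n v" if "v \<in> verts G" for v using f[of v] that xy unfolding \<phi>_def by auto
  have "\<phi> v \<noteq> v" if "v \<in> verts G" for v
    using \<phi>n[OF that] two[of "{v}"] by (auto simp: nbrs_def)
  then have maps: "\<phi> v \<in> verts G \<and> \<phi> v \<noteq> v" if "v \<in> verts G" for v
    using \<phi>n[OF that] nV that by blast
  have fibre: "card {v \<in> verts G. \<phi> v = u} \<le> 2" for u
  proof -
    let ?A = "{v \<in> verts G - {x}. f v = u}" and ?B = "if u = y then {x} else {}"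
    have "{v \<in> verts G. \<phi> v = u} = ?A \<union> ?B"
      using xV unfolding \<phi>_def by auto
    then have "card {v \<in> verts G. \<phi> v = u} \<le> card ?A + card ?B" by (simp only: card_Un_le)
    also have "\<dots> \<le> c u + card ?B" using fc by (rule add_right_mono)
    also have "\<dots> \<le> 2" using e(2) unfolding c_def by auto
    finally show ?thesis .
  qed
  have leaf: "\<phi> v \<noteq> x" if "v \<in> verts G" for v
  proof
    assume "\<phi> v = x"
    then have "v \<in> {v \<in> verts G - {x}. f v = x}" using that e(2) unfolding \<phi>_def by (auto split: if_splits)
    moreover have "{v \<in> verts G - {x}. f v = x} = {}" using fc[of x] finV by (simp add: c_def)
    ultimately show False by blast
  qed
  obtain M where M: "M \<subseteq> (\<lambda>v. {v, \<phi> v}) ` verts G"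
    "\<And>v. v \<in> verts G \<Longrightarrow> \<forall>u\<in>verts G. \<phi> u \<noteq> v \<Longrightarrow> {v, \<phi> v} \<in> M"
    "\<And>v. v \<in> verts G \<Longrightarrow> card (nbrs M v) \<in> {1, 2}"
    "\<And>v u w. card (nbrs M v) = 2 \<Longrightarrow> u \<in> nbrs M v \<Longrightarrow> w \<in> nbrs M v \<Longrightarrow>
       card (nbrs M u) = card (nbrs M w)"
    by (rule star_circuit_edges[OF finV maps fibre]) (assumption, rule that)
  define F :: "'a ugraph" where "F = \<lparr>verts = verts G, edges = M\<rparr>"
  have vF: "verts F = verts G" "edges F = M" unfolding F_def by auto
  have ME: "M \<subseteq> edges G" using M(1) \<phi>n by (auto simp: nbrs_def insert_commute)
  have sF: "simple_graph F" using sG ME unfolding simple_graph_def vF by auto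
  have "spanning_subgraph F G"
    using sF sG ME unfolding spanning_subgraph_def subgraph_def vF by simp
  moreover have "graph_iso C (star_graph 1) \<or> graph_iso C (star_graph 2) \<or> (\<exists>m\<ge>3. circuit m C)"
    if "graph_component C F" for C
  proof (rule star_circuit_component[OF sF _ _ that])
    show "card (nbrs (edges F) v) \<in> {1, 2}" if "v \<in> verts F" for v
      using that unfolding vF by (rule M(3))
    show "card (nbrs (edges F) u) = card (nbrs (edges F) w)"
      if "card (nbrs (edges F) v) = 2" "u \<in> nbrs (edges F) v" "w \<in> nbrs (edges F) v" for v u w
      using that unfolding vF by (rule M(4))
  qed
  moreover have "e \<in> edges F"
    using M(2)[OF xV] leaf unfolding vF e \<phi>_def by simp
  ultimately show ?thesis unfolding star_circuit_factor_def by blast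
qed

end
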